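(* Let $\Delta_n$ be a uniform flag triangulation of the boundary $\partial P_n$ of the root polytope belonging to the revlex class. For $1\le k\le n-1$, the number of facets consisting of $k$ forward arrows and $n-k$ backward arrows is $$f(\Delta_n,k,n-k)=\sum_{i=1}^{k}\sum_{j=1}^{n-k}\binom{k-1}{i-1}\binom{n-k-1}{j-1}\left[\binom{n-k+i-j}{i}\binom{k-i+j}{j}+\binom{n-k+i-j}{i-1}\binom{k-i+j}{j-1}\right].$$ The number of facets with $n$ forward arrows and no backward arrows, and the number of facets with no forward arrows and $n$ backward arrows, are both equal to $2^{n-1}$.
   Context: $P_n$ is the convex hull of $e_j-e_i$ ($i\ne j$) in $\mathbb{R}^{n+1}$. An arrow $(i,j)$, $i\ne j\in\{1,\dots,n+1\}$, with tail $i$ and head $j$, is identified with $e_j-e_i$; forward if $i<j$, backward if $i>j$; $V_n$ is the set of arrows. A uniform flag triangulation of $\partial P_n$ is a flag simplicial complex on $V_n$ representing a triangulation of $\partial P_n$ (no new vertices) in which whether a pair $\{(i_1,j_1),(i_2,j_2)\}$ is an edge depends only on the equalities and inequalities among $i_1,i_2,j_1,j_2$. For two arrows with four distinct endpoints $p_1<\dots<p_4$ the type is the $T/H$ word of tails/heads at $p_1,\dots,p_4$; the pair nests if it joins $\{p_1,p_4\},\{p_2,p_3\}$, crosses if it joins $\{p_1,p_3\},\{p_2,p_4\}$. The revlex class: nesting pairs of types $THTH$ and $HTHT$ are edges, and crossing pairs of types $THHT$ and $HTTH$ are edges. $f(\Delta_n,i,j)$ is the number of faces with $i$ forward and $j$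 backward arrows. *)

theory Defs
  imports "HOL-Analysis.Analysis"
begin

text \<open>
  An arrow is a pair (tail, head) of indices in \<open>{1..n+1}\<close>. The space \<open>\<real>\<^sup>n\<^sup>+\<^sup>1\<close> is a Euclidean space
  \<open>'a\<close> together with a numbering \<open>e\<close> of its standard basis by \<open>{1..n+1}\<close>.
\<close>

type_synonym arrow = "nat \<times> nat"

abbreviation tail :: "arrow \<Rightarrow> nat" where "tail \<equiv> fst"
abbreviation head :: "arrow \<Rightarrow> nat" where "head \<equiv> snd"

definition arrows :: "nat \<Rightarrow> arrow set" where
  "arrows n = {(i, j). i \<in> {1..n+1} \<and> j \<in> {1..n+1} \<and> i \<noteq> j}"

definition forward :: "arrow \<Rightarrow> bool" where
  "forward a \<longleftrightarrow> tail a < head a"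

definition backward :: "arrow \<Rightarrow> bool" where
  "backward a \<longleftrightarrow> tail a > head a"

definition arrow_vec :: "(nat \<Rightarrow> 'a::euclidean_space) \<Rightarrow> arrow \<Rightarrow> 'a" where
  "arrow_vec e a = e (head a) - e (tail a)"

definition root_polytope :: "nat \<Rightarrow> (nat \<Rightarrow> 'a::euclidean_space) \<Rightarrow> 'a set" where
  "root_polytope n e = convex hull (arrow_vec e ` arrows n)"

text \<open>
  Simplicial complexes are given by their sets of faces; the empty face is included.
\<close>

definition simplicial_complex_on :: "'v set \<Rightarrow> 'v set set \<Rightarrow> bool" where
  "simplicial_complex_on V K \<longleftrightarrow>
     {} \<in> K \<and> (\<forall>\<sigma>\<in>K. finite \<sigma> \<and> \<sigma> \<subseteq> V) \<and> (\<forall>v\<in>V. {v} \<in> K) \<and>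
     (\<forall>\<sigma>\<in>K. \<forall>\<tau>. \<tau> \<subseteq> \<sigma> \<longrightarrow> \<tau> \<in> K)"

definition flag_complex_on :: "'v set \<Rightarrow> 'v set set \<Rightarrow> bool" where
  "flag_complex_on V K \<longleftrightarrow> simplicial_complex_on V K \<and>
     (\<forall>\<sigma>. finite \<sigma> \<and> \<sigma> \<subseteq> V \<and> (\<forall>u\<in>\<sigma>. \<forall>v\<in>\<sigma>. u \<noteq> v \<longrightarrow> {u, v} \<in> K) \<longrightarrow> \<sigma> \<in> K)"

definition facets :: "'v set set \<Rightarrow> 'v set set" where
  "facets K = {\<sigma> \<in> K. \<forall>\<tau>\<in>K. \<sigma> \<subseteq> \<tau> \<longrightarrow> \<tau> = \<sigma>}"

text \<open>
  The polytope spans only a hyperplane of \<open>\<real>\<^sup>n\<^sup>+\<^sup>1\<close>, so its boundary is the relative frontier.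
  Affine independence of the vectors of each face makes the vertices of the simplex
  \<open>convex hull (arrow_vec e ` \<sigma>)\<close> exactly the arrows in \<open>\<sigma>\<close>.
\<close>

definition represents_boundary_triangulation ::
    "nat \<Rightarrow> (nat \<Rightarrow> 'a::euclidean_space) \<Rightarrow> arrow set set \<Rightarrow> bool" where
  "represents_boundary_triangulation n e K \<longleftrightarrow>
     (\<forall>\<sigma>\<in>K. \<not> affine_dependent (arrow_vec e ` \<sigma>)) \<and>
     triangulation ((\<lambda>\<sigma>. convex hull (arrow_vec e ` \<sigma>)) ` K) \<and>
     (\<Union>\<sigma>\<in>K. convex hull (arrow_vec e ` \<sigma>)) = rel_frontier (root_polytope n e)"

definition same_relative_order :: "nat list \<Rightarrow> nat list \<Rightarrow> bool" where
  "same_relative_order xs ys \<longleftrightarrow> length xs = length ys \<and>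
     (\<forall>s<length xs. \<forall>t<length xs.
        (xs ! s < xs ! t \<longleftrightarrow> ys ! s < ys ! t) \<and> (xs ! s = xs ! t \<longleftrightarrow> ys ! s = ys ! t))"

definition uniform :: "nat \<Rightarrow> arrow set set \<Rightarrow> bool" where
  "uniform n K \<longleftrightarrow>
     (\<forall>a\<in>arrows n. \<forall>b\<in>arrows n. \<forall>a'\<in>arrows n. \<forall>b'\<in>arrows n.
        same_relative_order [tail a, head a, tail b, head b] [tail a', head a', tail b', head b']
        \<longrightarrow> ({a, b} \<in> K \<longleftrightarrow> {a', b'} \<in> K))"

definition uniform_flag_triangulation ::
    "nat \<Rightarrow> (nat \<Rightarrow> 'a::euclidean_space) \<Rightarrow> arrow set set \<Rightarrow> bool" where
  "uniform_flag_triangulation n e K \<longleftrightarrow>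
     flag_complex_on (arrows n) K \<and> represents_boundary_triangulation n e K \<and> uniform n K"

datatype end_kind = T | H

definition endpoints :: "arrow \<Rightarrow> arrow \<Rightarrow> nat set" where
  "endpoints a b = {tail a, head a, tail b, head b}"

definition pair_type :: "arrow \<Rightarrow> arrow \<Rightarrow> end_kind list" where
  "pair_type a b =
     map (\<lambda>p. if p \<in> {tail a, tail b} then T else H) (sorted_list_of_set (endpoints a b))"

definition nests :: "arrow \<Rightarrow> arrow \<Rightarrow> bool" where
  "nests a b \<longleftrightarrow> (\<exists>p1 p2 p3 p4. p1 < p2 \<and> p2 < p3 \<and> p3 < p4 \<and>
     {{tail a, head a}, {tail b, head b}} = {{p1, p4}, {p2, p3}})"

definition crosses :: "arrow \<Rightarrow> arrow \<Rightarrow> bool" where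
  "crosses a b \<longleftrightarrow> (\<exists>p1 p2 p3 p4. p1 < p2 \<and> p2 < p3 \<and> p3 < p4 \<and>
     {{tail a, head a}, {tail b, head b}} = {{p1, p3}, {p2, p4}})"

definition revlex_class :: "nat \<Rightarrow> arrow set set \<Rightarrow> bool" where
  "revlex_class n K \<longleftrightarrow>
     (\<forall>a\<in>arrows n. \<forall>b\<in>arrows n.
        (nests a b \<and> pair_type a b \<in> {[T, H, T, H], [H, T, H, T]} \<longrightarrow> {a, b} \<in> K) \<and>
        (crosses a b \<and> pair_type a b \<in> {[T, H, H, T], [H, T, T, H]} \<longrightarrow> {a, b} \<in> K))"

definition has_counts :: "nat \<Rightarrow> nat \<Rightarrow> arrow set \<Rightarrow> bool" where
  "has_counts i j \<sigma> \<longleftrightarrow> card {a \<in> \<sigma>. forward a} = i \<and> card {a \<in> \<sigma>. backward a} = j"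

definition face_count :: "arrow set set \<Rightarrow> nat \<Rightarrow> nat \<Rightarrow> nat" where
  "face_count K i j = card {\<sigma> \<in> K. has_counts i j \<sigma>}"

definition facet_count :: "arrow set set \<Rightarrow> nat \<Rightarrow> nat \<Rightarrow> nat" where
  "facet_count K i j = card {\<sigma> \<in> facets K. has_counts i j \<sigma>}"

end

(*
  The midpoint of an edge {(i,j),(j,k)} would lie in the interior of P_n, and the midpoint of two
  arrows with tails i1, i2 and heads j1, j2 lies on the boundary and in the hull of exactly the two
  diagonals of the square i1, i2, j1, j2.  So no node of a face is both a tail and a head, and exactly
  one diagonal of every square is an edge.  In the revlex class this leaves free only the types TTHH
  and HHTT, where uniformity makes the choice once for all.  The faces are therefore the sets of
  arrows whose spans pairwise meet and whose forward (backward) arrows form a monotone staircase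
  in tails x heads, increasing or decreasing according to the two free choices.

  Let A, B be the tails and heads of the forward arrows of a face, C, D those of the backward ones.
  Every element of A Un D is at most every element of B Un C, and A, D and B, C are disjoint, so
  |A| + |B| + |C| + |D| <= n + 2, while staircases have at most |A| + |B| - 1 and |C| + |D| - 1
  elements.  If there are n arrows, of both directions, equality holds: A Un D = {1..p},
  B Un C = {p..n+1}, and p lies in both A and C or in neither.  The formula adds up the choices of
  A and C, where i = |A| and j = |C|, and of a full staircase in A x B and one in C x D.
*)
theory Submission
  imports Defs
begin

subsection \<open>Staircases\<close>

text \<open>The key \<open>h\<close> lets one notion serve both monotonicities: with
  \<open>h x = c * int x\<close> the staircase increases for c > 0 and decreases for c < 0.\<close>

definition staircase :: "('b \<Rightarrow> 'c::linorder) \<Rightarrow> ('a::linorder \<times> 'b) set \<Rightarrow> bool" where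
  "staircase h F \<longleftrightarrow> (\<forall>x\<in>F. \<forall>y\<in>F. fst x < fst y \<longrightarrow> h (snd x) \<le> h (snd y))"

text \<open>For finite nonempty \<open>A\<close> and \<open>B\<close> the prescribed size is the
  largest possible, by \<open>card_staircase_le\<close>; these are the monotone lattice paths
  between opposite corners of the grid.\<close>

definition full_staircases ::
    "('b \<Rightarrow> 'c::linorder) \<Rightarrow> 'a::linorder set \<Rightarrow> 'b set \<Rightarrow> ('a \<times> 'b) set set" where
  "full_staircases h A B = {F. F \<subseteq> A \<times> B \<and> staircase h F \<and> card F + 1 = card A + card B}"

lemma staircase_subset: "staircase h F \<Longrightarrow> G \<subseteq> F \<Longrightarrow> staircase h G"
  unfolding staircase_def by blast

lemma staircase_insert_top:
  assumes "staircase h F" "F \<subseteq> A \<times> B" "\<forall>x\<in>A. x \<le> a" "\<forall>y\<in>B. h y \<le> h b"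
  shows "staircase h (insert (a, b) F)"
  using assms unfolding staircase_def by (fastforce simp: leD)

text \<open>Apart from the corner \<open>(a, b)\<close>, the row of \<open>a\<close> and the column
  of \<open>b\<close> cannot both be used: cells \<open>(a, b')\<close> and \<open>(a', b)\<close>
  with \<open>a' < a\<close> force \<open>h b \<le> h b'\<close>, hence \<open>b' = b\<close> by
  injectivity.\<close>

lemma staircase_diff_top:
  assumes "inj h" "staircase h F" "F \<subseteq> A \<times> B" "\<forall>x\<in>A. x \<le> a" "\<forall>y\<in>B. h y \<le> h b"
  shows "F - {(a, b)} \<subseteq> (A - {a}) \<times> B \<or> F - {(a, b)} \<subseteq> A \<times> (B - {b})"
proof (rule ccontr)
  assume "\<not> ?thesis"
  then obtain a' b' where ab: "(a, b') \<in> F" "b' \<noteq> b" "(a', b) \<in> F" "a' \<noteq> a"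
    using assms(3) by fastforce
  then have "a' < a" "h b' \<le> h b"
    using assms(3-5) by (auto simp: order_less_le)
  moreover have "h b \<le> h b'"
    using assms(2) ab \<open>a' < a\<close> unfolding staircase_def by force
  ultimately show False
    using \<open>inj h\<close> ab(2) by (simp add: inj_eq)
qed

lemma obtain_top:
  fixes h :: "'b \<Rightarrow> 'c::linorder"
  assumes "finite B" "B \<noteq> {}"
  obtains b where "b \<in> B" "\<forall>y\<in>B. h y \<le> h b"
  using assms Max_in[of "h ` B"] Max_ge[of "h ` B"] by fastforce

text \<open>Removing the top corner leaves the last row or the last column empty, so the induction
  can delete that line of the grid.\<close>

lemma card_staircase_le:
  assumes "inj h" "finite A" "A \<noteq> {}" "finite B" "B \<noteq> {}" "staircase h F" "F \<subseteq> A \<times> B"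
  shows "card F + 1 \<le> card A + card B"
  using assms(2-)
proof (induction "card A + card B" arbitrary: A B F rule: less_induct)
  case less
  have pos: "card A > 0" "card B > 0"
    using less.prems by (auto simp: card_gt_0_iff)
  have le: "card F \<le> card A * card B"
    using card_mono[OF _ less.prems(6)] less.prems by (simp add: card_cartesian_product)
  show ?case
  proof (cases "card A = 1 \<or> card B = 1")
    \<comment> \<open>A grid with a side of length one has exactly
      \<open>card A + card B - 1\<close> cells. Treating it apart keeps the smaller grids below
      nonempty.\<close>
    case True
    then show ?thesis using le pos by auto
  next
    case False
    obtain a where a: "a \<in> A" "\<forall>x\<in>A. x \<le> a"
      using less.prems(1,2) obtain_top[of A "\<lambda>x. x"] by blast
    obtain b where b: "b \<in> B" "\<forall>y\<in>B. h y \<le> h b"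
      using less.prems(3,4) obtain_top by blast
    let ?F = "F - {(a, b)}"
    have st: "staircase h ?F"
      using less.prems(5) by (rule staircase_subset) auto
    have ne: "A - {a} \<noteq> {}" "B - {b} \<noteq> {}"
      using False a(1) b(1) by (auto dest!: subset_singletonD)
    have "card ?F + 1 \<le> card A + card B - 1"
      using staircase_diff_top[OF assms(1) less.prems(5,6) a(2) b(2)]
    proof
      assume "?F \<subseteq> (A - {a}) \<times> B"
      then show ?thesis
        using less.hyps[of "A - {a}" B ?F] st ne less.prems pos a(1) by simp
    next
      assume "?F \<subseteq> A \<times> (B - {b})"
      then show ?thesis
        using less.hyps[of A "B - {b}" ?F] st ne less.prems pos b(1) by simp
    qed
    moreover have "card F \<le> card ?F + 1"
      by (simp add: card_Diff_singleton_if) arith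
    ultimately show ?thesis using pos by linarith
  qed
qed

text \<open>\<open>F\<close> is also a staircase in the grid of its own projections. Were one of
  them smaller than \<open>A\<close> or \<open>B\<close>, the bound for that grid would fall below
  \<open>card F\<close>.\<close>

lemma fst_snd_full_staircase:
  assumes "inj h" "finite A" "A \<noteq> {}" "finite B" "B \<noteq> {}" "F \<in> full_staircases h A B"
  shows "fst ` F = A" "snd ` F = B"
proof -
  have F: "F \<subseteq> A \<times> B" "staircase h F" "card F + 1 = card A + card B"
    using assms(6) by (auto simp: full_staircases_def)
  have pos: "card A > 0" "card B > 0"
    using assms by (auto simp: card_gt_0_iff)
  then have "F \<noteq> {}" using F(3) by auto
  have sub: "fst ` F \<subseteq> A" "snd ` F \<subseteq> B" using F(1) by auto
  then have fin: "finite (fst ` F)" "finite (snd ` F)"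
    using assms finite_subset by blast+
  have "F \<subseteq> fst ` F \<times> snd ` F" by force
  then have "card A + card B \<le> card (fst ` F) + card (snd ` F)"
    using card_staircase_le[OF assms(1) fin(1) _ fin(2) _ F(2)] F(3) \<open>F \<noteq> {}\<close> by simp
  moreover have "card (fst ` F) \<le> card A" "card (snd ` F) \<le> card B"
    using sub assms by (simp_all add: card_mono)
  ultimately show "fst ` F = A" "snd ` F = B"
    using sub assms by (simp_all add: card_subset_eq)
qed

lemma finite_full_staircases: "finite A \<Longrightarrow> finite B \<Longrightarrow> finite (full_staircases h A B)"
  by (rule finite_subset[of _ "Pow (A \<times> B)"]) (auto simp: full_staircases_def)

text \<open>A full lattice path ends in the top corner; without this last cell it is a full path in
  the grid with the last row or the last column deleted.\<close>

lemma full_staircases_rec: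
  assumes "inj h" "finite A" "finite B" "a \<in> A" "b \<in> B" "\<forall>x\<in>A. x \<le> a" "\<forall>y\<in>B. h y \<le> h b"
  shows "full_staircases h A B =
    insert (a, b) ` (full_staircases h (A - {a}) B \<union> full_staircases h A (B - {b}))"
    (is "?L = insert _ ` (?M \<union> ?N)")
proof
  have pos: "card A > 0" "card B > 0"
    using assms by (auto simp: card_gt_0_iff)
  have fin: "finite F" if "F \<subseteq> A \<times> B" for F
    using that assms(2,3) finite_subset by blast
  show "?L \<subseteq> insert (a, b) ` (?M \<union> ?N)"
  proof
    fix F assume "F \<in> ?L"
    then have F: "F \<subseteq> A \<times> B" "staircase h F" "card F + 1 = card A + card B"
      by (auto simp: full_staircases_def)
    \<comment> \<open>The top corner can always be added to a staircase; if it were missing, adding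
      it would break the size bound.\<close>
    have "(a, b) \<in> F"
    proof (rule ccontr)
      assume "(a, b) \<notin> F"
      then have "card (insert (a, b) F) = card F + 1"
        using fin[OF F(1)] by simp
      moreover have "card (insert (a, b) F) + 1 \<le> card A + card B"
        using assms F(1) staircase_insert_top[OF F(2,1) assms(6,7)]
        by (intro card_staircase_le[OF assms(1)]) auto
      ultimately show False using F(3) by simp
    qed
    let ?F = "F - {(a, b)}"
    have "staircase h ?F"
      using F(2) by (rule staircase_subset) auto
    moreover have "card ?F + 1 = card A + card B - 1"
      using \<open>(a, b) \<in> F\<close> fin[OF F(1)] F(3) card_gt_0_iff[of F] by auto
    ultimately have "?F \<in> ?M \<union> ?N"
      using staircase_diff_top[OF assms(1) F(2,1) assms(6,7)] assms pos
      by (auto simp: full_staircases_def)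
    then show "F \<in> insert (a, b) ` (?M \<union> ?N)"
      using \<open>(a, b) \<in> F\<close> by (metis image_eqI insert_Diff)
  qed
  show "insert (a, b) ` (?M \<union> ?N) \<subseteq> ?L"
  proof
    fix F assume "F \<in> insert (a, b) ` (?M \<union> ?N)"
    then obtain G where G: "F = insert (a, b) G" "G \<in> ?M \<union> ?N" by blast
    then have *: "G \<subseteq> A \<times> B" "staircase h G" "(a, b) \<notin> G" "card G + 1 = card A + card B - 1"
      using assms pos by (auto simp: full_staircases_def)
    have "staircase h F"
      using staircase_insert_top[OF *(2,1) assms(6,7)] G(1) by simp
    then show "F \<in> ?L"
      using * G(1) assms(4,5) fin[OF *(1)] pos by (auto simp: full_staircases_def)
  qed
qed

text \<open>The two branches of \<open>full_staircases_rec\<close> are the two terms of Pascal's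
  rule.\<close>

lemma card_full_staircases:
  assumes "inj h" "finite A" "A \<noteq> {}" "finite B" "B \<noteq> {}"
  shows "card (full_staircases h A B) = (card A + card B - 2) choose (card A - 1)"
  using assms(2-)
proof (induction "card A + card B" arbitrary: A B rule: less_induct)
  case less
  have pos: "card A > 0" "card B > 0"
    using less.prems by (auto simp: card_gt_0_iff)
  show ?case
  proof (cases "card A = 1 \<or> card B = 1")
    case True
    have "full_staircases h A B = {A \<times> B}"
    proof (intro set_eqI iffI)
      fix F assume "F \<in> full_staircases h A B"
      then have "F \<subseteq> A \<times> B" "card F = card (A \<times> B)"
        using True by (auto simp: full_staircases_def card_cartesian_product)
      then show "F \<in> {A \<times> B}"
        using less.prems by (simp add: card_subset_eq)
    next
      fix F assume "F \<in> {A \<times> B}"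
      moreover have "staircase h (A \<times> B)"
        using True by (auto simp: staircase_def card_1_singleton_iff)
      ultimately show "F \<in> full_staircases h A B"
        using True by (auto simp: full_staircases_def card_cartesian_product)
    qed
    then show ?thesis using True by auto
  next
    case False
    obtain a where a: "a \<in> A" "\<forall>x\<in>A. x \<le> a"
      using less.prems(1,2) obtain_top[of A "\<lambda>x. x"] by blast
    obtain b where b: "b \<in> B" "\<forall>y\<in>B. h y \<le> h b"
      using less.prems(3,4) obtain_top by blast
    obtain p q where pq: "card A = p + 2" "card B = q + 2"
    proof -
      have "2 \<le> card A" "2 \<le> card B" using False pos by auto
      then show thesis using that by (metis le_add_diff_inverse2)
    qed
    then have cards: "card (A - {a}) = p + 1" "card (B - {b}) = q + 1"
      using a b less.prems by auto
    then have ne: "A - {a} \<noteq> {}" "B - {b} \<noteq> {}" by fastforce+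
    let ?M = "full_staircases h (A - {a}) B" and ?N = "full_staircases h A (B - {b})"
    \<comment> \<open>A common member would live in the grid with both lines deleted, where at most
      p + q + 1 cells fit, but it has p + q + 2.\<close>
    have "?M \<inter> ?N = {}"
    proof (rule ccontr)
      assume "?M \<inter> ?N \<noteq> {}"
      then obtain F where F: "F \<in> ?M" "F \<in> ?N" by blast
      then have "F \<subseteq> (A - {a}) \<times> (B - {b})" "staircase h F" "card F + 1 = p + q + 3"
        using cards pq by (auto simp: full_staircases_def)
      then show False
        using card_staircase_le[OF assms(1) _ ne(1) _ ne(2)] less.prems cards by fastforce
    qed
    moreover have "finite ?M" "finite ?N"
      using less.prems by (simp_all add: finite_full_staircases)
    moreover have "inj_on (insert (a, b)) (?M \<union> ?N)"
      by (rule inj_onI) (auto simp: full_staircases_def dest!: insert_ident[THEN iffD1, rotated 2])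
    ultimately have "card (full_staircases h A B) = card ?M + card ?N"
      using full_staircases_rec[OF assms(1) less.prems(1,3) a(1) b(1) a(2) b(2)]
      by (simp add: card_image card_Un_disjoint)
    also have "card ?M = (p + q + 1) choose p"
      using less.hyps[of "A - {a}" B] less.prems ne cards pq by simp
    also have "card ?N = (p + q + 1) choose (p + 1)"
      using less.hyps[of A "B - {b}"] less.prems ne cards pq by simp
    finally show ?thesis using pq by simp
  qed
qed

subsection \<open>Edges of the triangulation\<close>

lemma inner_basis:
  assumes "bij_betw e I Basis" "i \<in> I" "j \<in> I"
  shows "e i \<bullet> e j = (if i = j then 1 else 0)"
proof -
  have "e i \<in> Basis" "e j \<in> Basis" "e i = e j \<longleftrightarrow> i = j"
    using assms by (auto simp: bij_betw_def inj_on_def)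
  then show ?thesis by (simp add: inner_Basis)
qed

text \<open>Since \<open>f\<close> may identify elements of \<open>\<sigma>\<close>, each weight on
  the image is moved to one chosen preimage, and all other elements get weight 0.\<close>

lemma simplex_point_weights:
  assumes "finite \<sigma>" "x \<in> convex hull (f ` \<sigma>)"
  obtains u :: "'b \<Rightarrow> real" where "\<forall>a\<in>\<sigma>. u a \<ge> 0" "sum u \<sigma> = 1" "x = (\<Sum>a\<in>\<sigma>. u a *\<^sub>R f a)"
proof -
  obtain v where v: "\<forall>y\<in>f ` \<sigma>. v y \<ge> 0" "sum v (f ` \<sigma>) = 1" "(\<Sum>y\<in>f ` \<sigma>. v y *\<^sub>R y) = x"
    using assms(2) unfolding convex_hull_finite[OF finite_imageI[OF assms(1)]] by blast
  define g where "g = inv_into \<sigma> f"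
  have g: "\<forall>y\<in>f ` \<sigma>. g y \<in> \<sigma> \<and> f (g y) = y"
    by (auto simp: g_def inv_into_into f_inv_into_f)
  have inj: "inj_on g (f ` \<sigma>)"
    unfolding g_def by (rule inj_on_inv_into) simp
  let ?u = "\<lambda>a. if a \<in> g ` f ` \<sigma> then v (f a) else 0"
  have sub: "g ` f ` \<sigma> \<subseteq> \<sigma>" using g by blast
  have "sum ?u \<sigma> = sum ?u (g ` f ` \<sigma>)"
    using assms(1) sub by (intro sum.mono_neutral_right) auto
  also have "\<dots> = sum v (f ` \<sigma>)"
    using g by (subst sum.reindex[OF inj]) (auto intro!: sum.cong)
  finally have 1: "sum ?u \<sigma> = 1" using v by simp
  have "(\<Sum>a\<in>\<sigma>. ?u a *\<^sub>R f a) = (\<Sum>a\<in>g ` f ` \<sigma>. ?u a *\<^sub>R f a)"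
    using assms(1) sub by (intro sum.mono_neutral_right) auto
  also have "\<dots> = (\<Sum>y\<in>f ` \<sigma>. v y *\<^sub>R y)"
    using g by (subst sum.reindex[OF inj]) (auto intro!: sum.cong)
  finally show ?thesis
    using that[of ?u] 1 v g by auto
qed

text \<open>A segment from any \<open>y\<close> in \<open>S\<close> to \<open>c *\<^sub>R x\<close>
  can be prolonged inside \<open>S\<close>, because \<open>- y\<close> is available as well.\<close>

lemma rel_interior_shrink_symmetric:
  fixes S :: "'a::euclidean_space set"
  assumes "convex S" "\<And>y. y \<in> S \<Longrightarrow> - y \<in> S" "x \<in> S" "0 \<le> c" "c < 1"
  shows "c *\<^sub>R x \<in> rel_interior S"
proof -
  have "\<exists>t>1. (1 - t) *\<^sub>R y + t *\<^sub>R (c *\<^sub>R x) \<in> S" if "y \<in> S" for y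
  proof (intro exI conjI)
    \<comment> \<open>This value solves t - 1 + t c = 1, so the far end of the prolonged segment is
      a convex combination of \<open>- y\<close> and \<open>x\<close>.\<close>
    let ?t = "2 / (1 + c)"
    show "?t > 1" using assms by simp
    have [simp]: "1 + c \<noteq> 0" using assms(4) by simp
    have "?t - 1 \<ge> 0" "?t * c \<ge> 0" "?t - 1 + ?t * c = 1"
      using assms(4,5) by (simp_all add: divide_simps)
    then have "(?t - 1) *\<^sub>R (- y) + (?t * c) *\<^sub>R x \<in> S"
      using assms that by (intro convexD[OF assms(1)]) auto
    then show "(1 - ?t) *\<^sub>R y + ?t *\<^sub>R (c *\<^sub>R x) \<in> S"
      by (simp add: algebra_simps)
  qed
  then show ?thesis
    using assms by (subst convex_rel_interior_iff) auto
qed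

text \<open>Prolonging the segment from \<open>- x\<close> through \<open>x\<close> by a factor t >
  1 would raise \<open>w\<close> to 2 t - 1 > 1. Symmetry thus ensures that the supporting
  hyperplane does not contain \<open>S\<close>.\<close>

lemma rel_frontier_symmetric_support:
  fixes S :: "'a::euclidean_space set"
  assumes "convex S" "\<And>y. y \<in> S \<Longrightarrow> - y \<in> S" "x \<in> S" "\<And>y. y \<in> S \<Longrightarrow> w \<bullet> y \<le> 1" "w \<bullet> x = 1"
  shows "x \<in> rel_frontier S"
proof -
  have "x \<notin> rel_interior S"
  proof
    assume "x \<in> rel_interior S"
    then obtain t where t: "t > 1" "(1 - t) *\<^sub>R (- x) + t *\<^sub>R x \<in> S"
      using convex_rel_interior_iff[OF assms(1), of x] assms(2)[OF assms(3)] assms(3) by blast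
    then have "w \<bullet> ((1 - t) *\<^sub>R (- x) + t *\<^sub>R x) \<le> 1"
      using assms(4) by blast
    then show False using t(1) assms(5) by (simp add: inner_right_distrib inner_diff_right)
  qed
  then show ?thesis
    using assms(3) closure_subset by (auto simp: rel_frontier_def)
qed

section \<open>Constraints that the geometry of the root polytope puts on edges\<close>

lemma finite_arrows: "finite (arrows n)"
  by (rule finite_subset[of _ "{1..n+1} \<times> {1..n+1}"]) (auto simp: arrows_def)

context
  fixes n :: nat and e :: "nat \<Rightarrow> 'a::euclidean_space" and K :: "arrow set set"
  assumes e: "bij_betw e {1..n+1} Basis"
    and K: "flag_complex_on (arrows n) K"
    and tri: "represents_boundary_triangulation n e K"
begin

lemma inner_arrow_vec:
  assumes "a \<in> arrows n" "i \<in> {1..n+1}"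
  shows "e i \<bullet> arrow_vec e a = (if i = head a then 1 else 0) - (if i = tail a then 1 else 0)"
  using assms inner_basis[OF e] by (auto simp: arrow_vec_def arrows_def inner_diff_right)

lemma arrow_vec_in_root_polytope: "a \<in> arrows n \<Longrightarrow> arrow_vec e a \<in> root_polytope n e"
  unfolding root_polytope_def by (simp add: hull_inc)

lemma uminus_root_polytope:
  assumes "y \<in> root_polytope n e"
  shows "- y \<in> root_polytope n e"
proof -
  have "uminus ` arrow_vec e ` arrows n \<subseteq> arrow_vec e ` arrows n"
  proof clarify
    fix i j assume "(i, j) \<in> arrows n"
    then have "(j, i) \<in> arrows n" "- arrow_vec e (i, j) = arrow_vec e (j, i)"
      by (auto simp: arrows_def arrow_vec_def)
    then show "- arrow_vec e (i, j) \<in> arrow_vec e ` arrows n" by (metis imageI)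
  qed
  moreover have "- y \<in> convex hull (uminus ` arrow_vec e ` arrows n)"
    using assms convex_hull_linear_image[of uminus "arrow_vec e ` arrows n"]
    unfolding root_polytope_def
    by (metis image_eqI linear_uminus)
  ultimately show ?thesis
    unfolding root_polytope_def using hull_mono by blast
qed

lemma convex_root_polytope: "convex (root_polytope n e)"
  by (simp add: root_polytope_def)

lemma face_closed: "\<sigma> \<in> K \<Longrightarrow> \<tau> \<subseteq> \<sigma> \<Longrightarrow> \<tau> \<in> K"
  using K unfolding flag_complex_on_def simplicial_complex_on_def by blast

lemma face_arrows: "\<sigma> \<in> K \<Longrightarrow> finite \<sigma> \<and> \<sigma> \<subseteq> arrows n"
  using K unfolding flag_complex_on_def simplicial_complex_on_def by (elim conjE) (erule bspec)

text \<open>By flagness the faces are the cliques of the edge relation, so describing the edges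
  describes the complex.\<close>

lemma face_iff_pairs:
  "\<sigma> \<in> K \<longleftrightarrow> \<sigma> \<subseteq> arrows n \<and> (\<forall>a\<in>\<sigma>. \<forall>b\<in>\<sigma>. {a, b} \<in> K)"
  using K face_closed face_arrows finite_arrows finite_subset unfolding flag_complex_on_def
  by (smt (verit, best) empty_subsetI insert_subset)

lemma midpoint_in_hull:
  "(1/2) *\<^sub>R (x + y) \<in> convex hull {x, y :: 'a}"
  using midpoint_in_closed_segment[of x y] by (simp add: midpoint_def segment_convex_hull)

text \<open>The two vectors telescope: their midpoint is half the vector of
  \<open>(tail a, head b)\<close>, or 0 for opposite arrows. Either way it is interior to the
  symmetric polytope, while faces lie on the frontier.\<close>

lemma edge_head_ne_tail:
  assumes "{a, b} \<in> K"
  shows "head a \<noteq> tail b"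
proof
  assume eq: "head a = tail b"
  have ab: "a \<in> arrows n" "b \<in> arrows n"
    using face_arrows[OF assms] by auto
  let ?m = "(1/2) *\<^sub>R (arrow_vec e a + arrow_vec e b)"
  have "?m \<in> rel_frontier (root_polytope n e)"
    using tri UN_I[OF assms, of ?m "\<lambda>\<sigma>. convex hull (arrow_vec e ` \<sigma>)"] midpoint_in_hull
    unfolding represents_boundary_triangulation_def by simp
  moreover have "?m \<in> rel_interior (root_polytope n e)"
  proof (cases "tail a = head b")
    case True
    then have "?m = 0 *\<^sub>R arrow_vec e a"
      using eq by (simp add: arrow_vec_def)
    then show ?thesis
      using rel_interior_shrink_symmetric[OF convex_root_polytope uminus_root_polytope
          arrow_vec_in_root_polytope[OF ab(1)], of 0] by simp
  next
    case False
    then have "(tail a, head b) \<in> arrows n" "?m = (1/2) *\<^sub>R arrow_vec e (tail a, head b)"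
      using eq ab by (auto simp: arrow_vec_def arrows_def)
    then show ?thesis
      using rel_interior_shrink_symmetric[OF convex_root_polytope uminus_root_polytope
          arrow_vec_in_root_polytope, of _ "1/2"] by simp
  qed
  ultimately show False by (simp add: rel_frontier_def)
qed

text \<open>The midpoint of the first pair lies on the frontier, hence in some face. A supporting
  functional confines the arrows of positive weight to run from \<open>I\<close> to
  \<open>J\<close>, and the coordinates of the midpoint make every tail and head occur. Equal tails
  or heads are allowed; the two diagonals then coincide.\<close>

lemma diagonal_exists:
  assumes "{i1, i2, j1, j2} \<subseteq> {1..n+1}" "{i1, i2} \<inter> {j1, j2} = {}"
  shows "{(i1, j1), (i2, j2)} \<in> K \<or> {(i1, j2), (i2, j1)} \<in> K"
proof -
  define I J where "I = {i1, i2}" and "J = {j1, j2}"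
  \<comment> \<open>This functional is 1 on the arrows from \<open>I\<close> to \<open>J\<close> and
    smaller on all others, so it cuts out the face of the polytope that they span.\<close>
  define w where "w = (1/2) *\<^sub>R ((\<Sum>j\<in>J. e j) - (\<Sum>i\<in>I. e i))"
  define m where "m = (1/2) *\<^sub>R (arrow_vec e (i1, j1) + arrow_vec e (i2, j2))"
  have arr: "(i1, j1) \<in> arrows n" "(i2, j2) \<in> arrows n"
    using assms by (auto simp: arrows_def)
  have IJ: "I \<subseteq> {1..n+1}" "J \<subseteq> {1..n+1}" "I \<inter> J = {}"
    using assms by (auto simp: I_def J_def)
  have sum_vec: "(\<Sum>j\<in>X. e j) \<bullet> arrow_vec e a = of_bool (head a \<in> X) - of_bool (tail a \<in> X)"
    if "a \<in> arrows n" "X \<subseteq> {1..n+1}" for a X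
  proof -
    have "finite X" using that finite_subset by blast
    have "(\<Sum>j\<in>X. e j) \<bullet> arrow_vec e a =
        (\<Sum>j\<in>X. (if j = head a then 1 else 0) - (if j = tail a then 1 else 0))"
      unfolding inner_sum_left using that(2) inner_arrow_vec[OF that(1)] by (intro sum.cong) auto
    also have "\<dots> = (\<Sum>j\<in>X. if j = head a then 1 else 0) - (\<Sum>j\<in>X. if j = tail a then 1 else 0)"
      by (rule sum_subtractf)
    also have "\<dots> = of_bool (head a \<in> X) - of_bool (tail a \<in> X)"
      using \<open>finite X\<close> by simp
    finally show ?thesis .
  qed
  have w_vec: "w \<bullet> arrow_vec e a = (1/2) * (of_bool (head a \<in> J) - of_bool (tail a \<in> J)
      - (of_bool (head a \<in> I) - of_bool (tail a \<in> I)))" if "a \<in> arrows n" for a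
    using sum_vec[OF that IJ(1)] sum_vec[OF that IJ(2)] by (simp add: w_def inner_diff_left)
  have w_le: "w \<bullet> arrow_vec e a \<le> 1" if "a \<in> arrows n" for a
    unfolding w_vec[OF that] by (simp add: of_bool_def)
  have w_eq: "tail a \<in> I \<and> head a \<in> J" if "a \<in> arrows n" "w \<bullet> arrow_vec e a = 1" for a
    using that(2) unfolding w_vec[OF that(1)] by (auto simp: of_bool_def split: if_splits)
  have "m \<in> root_polytope n e"
    using arr unfolding m_def scaleR_right_distrib
    by (intro convexD[OF convex_root_polytope]) (auto simp: arrow_vec_in_root_polytope)
  moreover have "w \<bullet> y \<le> 1" if "y \<in> root_polytope n e" for y
  proof -
    have "root_polytope n e \<subseteq> {y. w \<bullet> y \<le> 1}"
      unfolding root_polytope_def by (rule hull_minimal) (auto simp: w_le convex_halfspace_le)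
    then show ?thesis using that by blast
  qed
  moreover have "w \<bullet> m = 1"
    using IJ(3) w_vec[OF arr(1)] w_vec[OF arr(2)]
    by (auto simp: m_def inner_right_distrib I_def J_def)
  ultimately have "m \<in> rel_frontier (root_polytope n e)"
    using convex_root_polytope uminus_root_polytope rel_frontier_symmetric_support by blast
  then obtain \<sigma> where \<sigma>: "\<sigma> \<in> K" "m \<in> convex hull (arrow_vec e ` \<sigma>)"
    using tri unfolding represents_boundary_triangulation_def by blast
  have fin: "finite \<sigma>" and sub: "\<sigma> \<subseteq> arrows n"
    using face_arrows[OF \<sigma>(1)] by auto
  obtain u where u: "\<forall>a\<in>\<sigma>. u a \<ge> 0" "sum u \<sigma> = 1" "m = (\<Sum>a\<in>\<sigma>. u a *\<^sub>R arrow_vec e a)"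
    using simplex_point_weights[OF fin \<sigma>(2)] by blast
  have inner_m: "z \<bullet> m = (\<Sum>a\<in>\<sigma>. u a * (z \<bullet> arrow_vec e a))" for z
    by (simp add: u(3) inner_sum_right)
  \<comment> \<open>The slacks \<open>1 - w \<bullet> arrow_vec e a\<close>, weighted by
    \<open>u\<close>, are nonnegative and sum to 0, so each product vanishes.\<close>
  have supp: "tail a \<in> I \<and> head a \<in> J" if "a \<in> \<sigma>" "u a > 0" for a
  proof -
    have "(\<Sum>a\<in>\<sigma>. u a * (1 - w \<bullet> arrow_vec e a)) = 0"
      using inner_m[of w] \<open>w \<bullet> m = 1\<close> u(2) by (simp add: right_diff_distrib sum_subtractf)
    moreover have "\<forall>a\<in>\<sigma>. u a * (1 - w \<bullet> arrow_vec e a) \<ge> 0"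
      using u(1) w_le sub by (auto intro!: mult_nonneg_nonneg)
    ultimately have "u a * (1 - w \<bullet> arrow_vec e a) = 0"
      using that(1) fin by (simp add: sum_nonneg_eq_0_iff)
    then show ?thesis using w_eq[of a] that sub by auto
  qed
  have pos: "\<exists>a\<in>\<sigma>. u a > 0 \<and> z \<bullet> arrow_vec e a > 0" if "z \<bullet> m > 0" for z
  proof (rule ccontr)
    assume "\<not> ?thesis"
    then have "\<forall>a\<in>\<sigma>. u a * (z \<bullet> arrow_vec e a) \<le> 0"
      using u(1) by (metis linorder_not_less mult_nonneg_nonpos mult_zero_left order_le_less)
    then show False using that inner_m[of z] by (simp add: sum_nonpos leD)
  qed
  \<comment> \<open>Only arrows with head \<open>j\<close> have a positive coordinate at
    \<open>j\<close>; \<open>tail_supp\<close> argues in the same way with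
    \<open>- e i\<close>.\<close>
  have head_supp: "\<exists>i\<in>I. (i, j) \<in> \<sigma>" if "j \<in> J" for j
  proof -
    have j: "j \<in> {1..n+1}" using that IJ by auto
    have "e j \<bullet> m > 0"
      using that IJ(3) inner_arrow_vec[OF arr(1) j] inner_arrow_vec[OF arr(2) j]
      by (auto simp: m_def inner_right_distrib I_def J_def)
    then obtain a where a: "a \<in> \<sigma>" "u a > 0" "e j \<bullet> arrow_vec e a > 0" using pos by blast
    then have "head a = j"
      using inner_arrow_vec[of a j] j sub by (auto split: if_splits)
    then show ?thesis using a supp by (metis prod.collapse)
  qed
  have tail_supp: "\<exists>j\<in>J. (i, j) \<in> \<sigma>" if "i \<in> I" for i
  proof -
    have i: "i \<in> {1..n+1}" using that IJ by auto
    have "(- e i) \<bullet> m > 0"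
      using that IJ(3) inner_arrow_vec[OF arr(1) i] inner_arrow_vec[OF arr(2) i]
      by (auto simp: m_def inner_right_distrib I_def J_def)
    then obtain a where a: "a \<in> \<sigma>" "u a > 0" "(- e i) \<bullet> arrow_vec e a > 0" using pos by blast
    then have "tail a = i"
      using inner_arrow_vec[of a i] i sub by (auto split: if_splits)
    then show ?thesis using a supp by (metis prod.collapse)
  qed
  \<comment> \<open>A bipartite graph on two tails and two heads without isolated nodes has a
    perfect matching.\<close>
  have "{(i1, j1), (i2, j2)} \<subseteq> \<sigma> \<or> {(i1, j2), (i2, j1)} \<subseteq> \<sigma>"
    using head_supp[of j1] head_supp[of j2] tail_supp[of i1] tail_supp[of i2]
    by (auto simp: I_def J_def)
  then show ?thesis using face_closed[OF \<sigma>(1)] by blast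
qed

text \<open>Both diagonals have the same midpoint. If both were edges, their common part would be a
  face of the first segment containing an inner point, hence also its first endpoint; but
  \<open>e j1 - e i1\<close> takes the value 2 there and 1 on the whole second segment.\<close>

lemma diagonal_unique:
  assumes "{(i1, j1), (i2, j2)} \<in> K" "i1 \<noteq> i2" "j1 \<noteq> j2"
  shows "{(i1, j2), (i2, j1)} \<notin> K"
proof
  assume K2: "{(i1, j2), (i2, j1)} \<in> K"
  let ?S = "\<lambda>\<sigma>. convex hull (arrow_vec e ` \<sigma>)"
  let ?A = "arrow_vec e (i1, j1)" and ?B = "arrow_vec e (i2, j2)"
  let ?C = "arrow_vec e (i1, j2)" and ?D = "arrow_vec e (i2, j1)"
  have arr: "(i1, j1) \<in> arrows n" "(i2, j2) \<in> arrows n" "(i1, j2) \<in> arrows n" "(i2, j1) \<in> arrows n"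
    using face_arrows[OF assms(1)] face_arrows[OF K2] by auto
  then have rng: "i1 \<in> {1..n+1}" "j1 \<in> {1..n+1}" "i1 \<noteq> j1" "i1 \<noteq> j2" "i2 \<noteq> j1"
    by (auto simp: arrows_def)
  let ?m = "midpoint ?A ?B"
  have "?m = midpoint ?C ?D"
    by (simp add: midpoint_def arrow_vec_def)
  moreover have "midpoint x y \<in> convex hull {x, y}" for x y :: 'a
    by (simp flip: segment_convex_hull)
  ultimately have m: "?m \<in> ?S {(i1, j1), (i2, j2)} \<inter> ?S {(i1, j2), (i2, j1)}"
    by (metis IntI image_empty image_insert)
  have face: "?S {(i1, j1), (i2, j2)} \<inter> ?S {(i1, j2), (i2, j1)} face_of ?S {(i1, j1), (i2, j2)}"
    using tri assms(1) K2 unfolding represents_boundary_triangulation_def triangulation_def by blast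
  let ?w = "e j1 - e i1"
  have w: "?w \<bullet> ?A = 2" "?w \<bullet> ?C = 1" "?w \<bullet> ?D = 1" "?w \<bullet> ?B = 0"
    using inner_arrow_vec rng assms arr by (auto simp: inner_diff_left)
  then have "?A \<noteq> ?B" by auto
  then have "?m \<in> open_segment ?A ?B" by simp
  then have "?A \<in> ?S {(i1, j2), (i2, j1)}"
    using face_ofD[OF face _ _ _ m, of ?A ?B] by (simp add: hull_inc)
  moreover have "?S {(i1, j2), (i2, j1)} \<subseteq> {y. ?w \<bullet> y = 1}"
    using w by (intro hull_minimal) (auto simp: convex_hyperplane)
  ultimately show False using w(1) by auto
qed

end

text \<open>This is half of a symmetric relation: an edge needs it for both orders of the pair, and
  then the two \<open>min\<close>/\<open>max\<close> conditions say that the spans intersect. Only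
  the signs of \<open>s\<close> and \<open>t\<close> matter; they orient the forward and the
  backward staircase.\<close>

definition compatible :: "int \<Rightarrow> int \<Rightarrow> arrow \<Rightarrow> arrow \<Rightarrow> bool" where
  "compatible s t a b \<longleftrightarrow>
     tail a \<noteq> head b \<and> min (tail a) (head a) \<le> max (tail b) (head b) \<and>
     (forward a \<and> forward b \<and> tail a < tail b \<longrightarrow> s * int (head a) \<le> s * int (head b)) \<and>
     (backward a \<and> backward b \<and> tail a < tail b \<longrightarrow> t * int (head a) \<le> t * int (head b))"

definition compatible_sets :: "nat \<Rightarrow> int \<Rightarrow> int \<Rightarrow> arrow set set" where
  "compatible_sets n s t = {\<sigma>. \<sigma> \<subseteq> arrows n \<and> (\<forall>a\<in>\<sigma>. \<forall>b\<in>\<sigma>. compatible s t a b)}"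

text \<open>In each of the four types the other matching of the same tails and heads has disjoint
  spans, so the class always prefers the pair whose spans meet.\<close>

lemma revlex_edges:
  assumes "revlex_class n K" "p1 < p2" "p2 < p3" "p3 < p4" "1 \<le> p1" "p4 \<le> n + 1"
  shows "{(p1, p4), (p3, p2)} \<in> K" "{(p4, p1), (p2, p3)} \<in> K"
    "{(p1, p3), (p4, p2)} \<in> K" "{(p3, p1), (p2, p4)} \<in> K"
proof -
  have sorted: "sorted_list_of_set X = [p1, p2, p3, p4]" if "X = set [p1, p2, p3, p4]" for X
    unfolding that using assms by (intro sorted_list_of_set.idem_if_sorted_distinct) auto
  have "endpoints (p1, p4) (p3, p2) = set [p1, p2, p3, p4]"
    "endpoints (p4, p1) (p2, p3) = set [p1, p2, p3, p4]"
    "endpoints (p1, p3) (p4, p2) = set [p1, p2, p3, p4]"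
    "endpoints (p3, p1) (p2, p4) = set [p1, p2, p3, p4]"
    by (auto simp: endpoints_def)
  note srt = this[THEN sorted]
  have ty: "pair_type (p1, p4) (p3, p2) = [T, H, T, H]" "pair_type (p4, p1) (p2, p3) = [H, T, H, T]"
    "pair_type (p1, p3) (p4, p2) = [T, H, H, T]" "pair_type (p3, p1) (p2, p4) = [H, T, T, H]"
    using assms by (simp_all add: pair_type_def srt)
  have "nests (p1, p4) (p3, p2)" "nests (p4, p1) (p2, p3)"
    unfolding nests_def using assms(2-4)
    by (rule_tac [!] exI[of _ p1], rule_tac [!] exI[of _ p2], rule_tac [!] exI[of _ p3],
        rule_tac [!] exI[of _ p4]) (simp_all add: insert_commute)
  moreover have "crosses (p1, p3) (p4, p2)" "crosses (p3, p1) (p2, p4)"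
    unfolding crosses_def using assms(2-4)
    by (rule_tac [!] exI[of _ p1], rule_tac [!] exI[of _ p2], rule_tac [!] exI[of _ p3],
        rule_tac [!] exI[of _ p4]) (simp_all add: insert_commute)
  moreover have "{(p1, p4), (p3, p2), (p4, p1), (p2, p3), (p1, p3), (p4, p2), (p3, p1), (p2, p4)} \<subseteq> arrows n"
    using assms by (auto simp: arrows_def)
  ultimately show "{(p1, p4), (p3, p2)} \<in> K" "{(p4, p1), (p2, p3)} \<in> K"
    "{(p1, p3), (p4, p2)} \<in> K" "{(p3, p1), (p2, p4)} \<in> K"
    using assms(1) ty unfolding revlex_class_def by blast+
qed

text \<open>A pair with four distinct endpoints, no tail being a head, is a diagonal of a square.
  For four types the class names the edge; for TTHH and HHTT the signs \<open>s\<close> and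
  \<open>t\<close> record the uniform choice between crossing (1) and nesting (-1).\<close>

lemma edge_iff_compatible:
  assumes head_ne_tail: "\<And>a b. {a, b} \<in> K \<Longrightarrow> head a \<noteq> tail b"
    and diagonal: "\<And>i1 i2 j1 j2. {i1, i2, j1, j2} \<subseteq> {1..n+1} \<Longrightarrow> {i1, i2} \<inter> {j1, j2} = {} \<Longrightarrow>
      {(i1, j1), (i2, j2)} \<in> K \<or> {(i1, j2), (i2, j1)} \<in> K"
    and unique: "\<And>i1 i2 j1 j2. {(i1, j1), (i2, j2)} \<in> K \<Longrightarrow> i1 \<noteq> i2 \<Longrightarrow> j1 \<noteq> j2 \<Longrightarrow>
      {(i1, j2), (i2, j1)} \<notin> K"
    and "uniform n K" "revlex_class n K"
  obtains s t :: int where "s \<noteq> 0" "t \<noteq> 0"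
    "\<And>a b. a \<in> arrows n \<Longrightarrow> b \<in> arrows n \<Longrightarrow>
      {a, b} \<in> K \<longleftrightarrow> compatible s t a b \<and> compatible s t b a"
proof -
  define P where "P = (\<lambda>p1 p2 p3 p4 :: nat. p1 < p2 \<and> p2 < p3 \<and> p3 < p4 \<and> 1 \<le> p1 \<and> p4 \<le> n + 1)"
  have forward_uniform: "{(p1, p3), (p2, p4)} \<in> K \<longleftrightarrow> {(q1, q3), (q2, q4)} \<in> K"
    if "P p1 p2 p3 p4" "P q1 q2 q3 q4" for p1 p2 p3 p4 q1 q2 q3 q4
  proof -
    have "{(p1, p3), (p2, p4), (q1, q3), (q2, q4)} \<subseteq> arrows n"
      using that by (auto simp: P_def arrows_def)
    moreover have "same_relative_order [p1, p3, p2, p4] [q1, q3, q2, q4]"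
      using that by (auto simp: P_def same_relative_order_def All_less_Suc)
    ultimately show ?thesis
      using \<open>uniform n K\<close> unfolding uniform_def by simp
  qed
  have backward_uniform: "{(p3, p1), (p4, p2)} \<in> K \<longleftrightarrow> {(q3, q1), (q4, q2)} \<in> K"
    if "P p1 p2 p3 p4" "P q1 q2 q3 q4" for p1 p2 p3 p4 q1 q2 q3 q4
  proof -
    have "{(p3, p1), (p4, p2), (q3, q1), (q4, q2)} \<subseteq> arrows n"
      using that by (auto simp: P_def arrows_def)
    moreover have "same_relative_order [p3, p1, p4, p2] [q3, q1, q4, q2]"
      using that by (auto simp: P_def same_relative_order_def All_less_Suc)
    ultimately show ?thesis
      using \<open>uniform n K\<close> unfolding uniform_def by simp
  qed
  \<comment> \<open>By uniformity one witness speaks for all quadruples. For n < 3 there are none,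
    and the sign -1 is a harmless default since no pair of this type occurs.\<close>
  define f where "f \<longleftrightarrow> (\<exists>p1 p2 p3 p4. P p1 p2 p3 p4 \<and> {(p1, p3), (p2, p4)} \<in> K)"
  define g where "g \<longleftrightarrow> (\<exists>p1 p2 p3 p4. P p1 p2 p3 p4 \<and> {(p3, p1), (p4, p2)} \<in> K)"
  define s t :: int where "s = (if f then 1 else -1)" and "t = (if g then 1 else -1)"
  have s: "{(p1, p3), (p2, p4)} \<in> K \<longleftrightarrow> s = 1" if "P p1 p2 p3 p4" for p1 p2 p3 p4
  proof -
    have "{(p1, p3), (p2, p4)} \<in> K \<longleftrightarrow> f"
      unfolding f_def using forward_uniform[OF that] that by blast
    then show ?thesis by (simp add: s_def)
  qed
  have t: "{(p3, p1), (p4, p2)} \<in> K \<longleftrightarrow> t = 1" if "P p1 p2 p3 p4" for p1 p2 p3 p4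
  proof -
    have "{(p3, p1), (p4, p2)} \<in> K \<longleftrightarrow> g"
      unfolding g_def using backward_uniform[OF that] that by blast
    then show ?thesis by (simp add: t_def)
  qed
  have st: "s = 1 \<or> s = -1" "t = 1 \<or> t = -1" by (auto simp: s_def t_def)
  note rev = revlex_edges[OF \<open>revlex_class n K\<close>]
  have distinct_case: "{(i, j), (k, l)} \<in> K \<longleftrightarrow> compatible s t (i, j) (k, l) \<and> compatible s t (k, l) (i, j)"
    if order: "{i, j, k, l} \<subseteq> {1..n+1}" "i < k" "i \<noteq> j" "i \<noteq> l" "k \<noteq> j" "k \<noteq> l" "j \<noteq> l" for i j k l
  proof -
    \<comment> \<open>Exactly one diagonal of the square is an edge, so a decision about the other
      diagonal settles this one.\<close>
    have flip: "{(i, j), (k, l)} \<in> K \<longleftrightarrow> {(i, l), (k, j)} \<notin> K"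
    proof -
      have "{i, k, j, l} \<subseteq> {1..n+1}" "{i, k} \<inter> {j, l} = {}"
        using that by auto
      from diagonal[OF this] unique[of i j k l] \<open>i < k\<close> \<open>j \<noteq> l\<close> show ?thesis
        by linarith
    qed
    note defs = compatible_def forward_def backward_def
    \<comment> \<open>With \<open>i < k\<close> there are twelve orders of the endpoints.
      Consecutive cases are the two matchings of one type, in the sequence TTHH, THTH, THHT, HTTH,
      HTHT, HHTT.\<close>
    have "j < i \<or> i < j \<and> j < k \<or> k < j" "l < i \<or> i < l \<and> l < k \<or> k < l" "j < l \<or> l < j"
      using order by auto
    then consider "k < j" "j < l" | "k < l" "l < j" | "i < j" "j < k" "k < l" | "i < l" "l < k" "k < j"
      | "i < j" "j < l" "l < k" | "i < l" "l < j" "j < k" | "j < i" "k < l" | "l < i" "k < j"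
      | "j < i" "i < l" "l < k" | "l < i" "i < j" "j < k" | "j < l" "l < i" | "l < j" "j < i"
      by - (elim disjE conjE, simp_all)
    then show ?thesis
    proof cases
      case 1
      then show ?thesis using that s[of i k j l] st by (auto simp: P_def defs)
    next
      case 2
      then show ?thesis using that s[of i k l j] st flip by (auto simp: P_def defs)
    next
      case 3
      then show ?thesis using that rev(1)[of i j k l] flip by (auto simp: defs)
    next
      case 4
      then show ?thesis using that rev(1)[of i l k j] by (auto simp: defs)
    next
      case 5
      then show ?thesis using that rev(3)[of i j l k] flip by (auto simp: defs)
    next
      case 6
      then show ?thesis using that rev(3)[of i l j k] by (auto simp: defs)
    next
      case 7
      then show ?thesis using that rev(4)[of j i k l] flip by (auto simp: defs insert_commute)
    next
      case 8
      then show ?thesis using that rev(4)[of l i k j] by (auto simp: defs insert_commute)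
    next
      case 9
      then show ?thesis using that rev(2)[of j i l k] flip by (auto simp: defs insert_commute)
    next
      case 10
      then show ?thesis using that rev(2)[of l i j k] by (auto simp: defs insert_commute)
    next
      case 11
      then show ?thesis using that t[of j l i k] st by (auto simp: P_def defs)
    next
      case 12
      then show ?thesis using that t[of l j i k] st flip by (auto simp: P_def defs)
    qed
  qed
  have main: "{a, b} \<in> K \<longleftrightarrow> compatible s t a b \<and> compatible s t b a"
    if "a \<in> arrows n" "b \<in> arrows n" for a b
  proof -
    obtain i j k l where ab: "a = (i, j)" "b = (k, l)" by force
    have rng: "{i, j, k, l} \<subseteq> {1..n+1}" "i \<noteq> j" "k \<noteq> l"
      using that by (auto simp: ab arrows_def)
    consider "i = l \<or> k = j" | "i \<noteq> l" "k \<noteq> j" "i = k \<or> j = l"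
      | "i \<noteq> l" "k \<noteq> j" "i < k" "j \<noteq> l" | "i \<noteq> l" "k \<noteq> j" "k < i" "j \<noteq> l"
      by linarith
    then show ?thesis
    proof cases
      case 1
      then show ?thesis
        using head_ne_tail[of a b] head_ne_tail[of b a] by (auto simp: ab compatible_def insert_commute)
    next
      \<comment> \<open>A common tail or head makes both diagonals the same pair, which is therefore
        an edge.\<close>
      case 2
      then have "{a, b} \<in> K"
        using diagonal[of i k j l] rng by (auto simp: ab insert_commute)
      moreover have "compatible s t a b" "compatible s t b a"
        using 2 by (auto simp: ab compatible_def)
      ultimately show ?thesis by simp
    next
      case 3
      then show ?thesis using distinct_case[of i j k l] rng by (auto simp: ab)
    next
      case 4
      then show ?thesis using distinct_case[of k l i j] rng by (auto simp: ab insert_commute)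
    qed
  qed
  show ?thesis
    using that[of s t] st main by auto
qed

subsection \<open>Faces of the triangulation\<close>

text \<open>Intended for forward arrows with tails \<open>A\<close> and heads \<open>B\<close> and
  backward arrows with tails \<open>C\<close> and heads \<open>D\<close>. The left ends
  \<open>A \<union> D\<close> precede the right ends \<open>B \<union> C\<close>, and equality is
  possible only between two tails or two heads.\<close>

definition interlaced :: "'a::linorder set \<Rightarrow> 'a set \<Rightarrow> 'a set \<Rightarrow> 'a set \<Rightarrow> bool" where
  "interlaced A B C D \<longleftrightarrow>
     (\<forall>a\<in>A. \<forall>b\<in>B. a < b) \<and> (\<forall>d\<in>D. \<forall>c\<in>C. d < c) \<and>
     (\<forall>a\<in>A. \<forall>c\<in>C. a \<le> c) \<and> (\<forall>d\<in>D. \<forall>b\<in>B. d \<le> b) \<and> A \<inter> D = {} \<and> B \<inter> C = {}"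

lemma interlacedD:
  assumes "interlaced A B C D"
  shows "\<forall>a\<in>A. \<forall>b\<in>B. a < b" "\<forall>d\<in>D. \<forall>c\<in>C. d < c" "A \<inter> D = {}" "B \<inter> C = {}"
  using assms by (simp_all add: interlaced_def)

lemma interlaced_le: "interlaced A B C D \<Longrightarrow> \<forall>x\<in>A \<union> D. \<forall>y\<in>B \<union> C. x \<le> y"
  unfolding interlaced_def by (blast intro: less_imp_le)

text \<open>Spans meet when each left end is at most the other right end, so over all pairs this
  compares only the four sets of ends. For equal directions the inequality becomes strict because no
  head is a tail. What remains is the monotonicity within each direction.\<close>

lemma compatible_sets_iff:
  fixes \<sigma> :: "arrow set"
  defines "F \<equiv> {a \<in> \<sigma>. forward a}" and "G \<equiv> {a \<in> \<sigma>. backward a}"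
  shows "\<sigma> \<in> compatible_sets n s t \<longleftrightarrow> \<sigma> \<subseteq> arrows n \<and>
    interlaced (tail ` F) (head ` F) (tail ` G) (head ` G) \<and>
    staircase (\<lambda>x. s * int x) F \<and> staircase (\<lambda>x. t * int x) G"
    (is "_ \<longleftrightarrow> _ \<and> ?R")
proof (cases "\<sigma> \<subseteq> arrows n")
  case True
  have \<sigma>: "\<sigma> = F \<union> G" "\<forall>a\<in>F. tail a < head a" "\<forall>a\<in>G. head a < tail a"
    using True by (auto simp: F_def G_def forward_def backward_def arrows_def)
  have "(\<forall>a\<in>\<sigma>. \<forall>b\<in>\<sigma>. compatible s t a b) \<longleftrightarrow>
      (\<forall>a\<in>F. \<forall>b\<in>F. compatible s t a b) \<and> (\<forall>a\<in>G. \<forall>b\<in>G. compatible s t a b) \<and>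
      (\<forall>a\<in>F. \<forall>b\<in>G. compatible s t a b \<and> compatible s t b a)"
    unfolding \<sigma>(1) by blast
  moreover have "(\<forall>a\<in>F. \<forall>b\<in>F. compatible s t a b) \<longleftrightarrow>
      (\<forall>a\<in>F. \<forall>b\<in>F. tail a < head b) \<and> staircase (\<lambda>x. s * int x) F"
  proof -
    have "compatible s t a b \<longleftrightarrow>
        tail a < head b \<and> (tail a < tail b \<longrightarrow> s * int (head a) \<le> s * int (head b))"
      if "a \<in> F" "b \<in> F" for a b
      using \<sigma>(2) that by (fastforce simp: compatible_def forward_def backward_def)
    then have "(\<forall>a\<in>F. \<forall>b\<in>F. compatible s t a b) \<longleftrightarrow> (\<forall>a\<in>F. \<forall>b\<in>F.
        tail a < head b \<and> (tail a < tail b \<longrightarrow> s * int (head a) \<le> s * int (head b)))"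
      by (intro ball_cong refl)
    then show ?thesis unfolding staircase_def by blast
  qed
  moreover have "(\<forall>a\<in>G. \<forall>b\<in>G. compatible s t a b) \<longleftrightarrow>
      (\<forall>a\<in>G. \<forall>b\<in>G. head a < tail b) \<and> staircase (\<lambda>x. t * int x) G"
  proof -
    have "compatible s t a b \<longleftrightarrow>
        head a \<le> tail b \<and> head b \<noteq> tail a \<and> (tail a < tail b \<longrightarrow> t * int (head a) \<le> t * int (head b))"
      if "a \<in> G" "b \<in> G" for a b
      using \<sigma>(3) that by (fastforce simp: compatible_def forward_def backward_def)
    then have "(\<forall>a\<in>G. \<forall>b\<in>G. compatible s t a b) \<longleftrightarrow> (\<forall>a\<in>G. \<forall>b\<in>G.
        head a \<le> tail b \<and> head b \<noteq> tail a \<and> (tail a < tail b \<longrightarrow> t * int (head a) \<le> t * int (head b)))"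
      by (intro ball_cong refl)
    then show ?thesis unfolding staircase_def order_less_le[of "head _"] by blast
  qed
  moreover have "compatible s t a b \<and> compatible s t b a \<longleftrightarrow>
      tail a \<le> tail b \<and> head b \<le> head a \<and> tail a \<noteq> head b \<and> tail b \<noteq> head a"
    if "a \<in> F" "b \<in> G" for a b
    using \<sigma>(2,3) that by (fastforce simp: compatible_def forward_def backward_def)
  ultimately have "(\<forall>a\<in>\<sigma>. \<forall>b\<in>\<sigma>. compatible s t a b) \<longleftrightarrow>
      (\<forall>a\<in>F. \<forall>b\<in>F. tail a < head b) \<and> staircase (\<lambda>x. s * int x) F \<and>
      (\<forall>a\<in>G. \<forall>b\<in>G. head a < tail b) \<and> staircase (\<lambda>x. t * int x) G \<and>
      (\<forall>a\<in>F. \<forall>b\<in>G. tail a \<le> tail b \<and> head b \<le> head a \<and> tail a \<noteq> head b \<and> tail b \<noteq> head a)"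
    by simp
  also have "\<dots> \<longleftrightarrow> ?R"
  proof -
    have dis1: "tail ` F \<inter> head ` G = {} \<longleftrightarrow> (\<forall>a\<in>F. \<forall>b\<in>G. tail a \<noteq> head b)"
      by blast
    have dis2: "head ` F \<inter> tail ` G = {} \<longleftrightarrow> (\<forall>a\<in>F. \<forall>b\<in>G. tail b \<noteq> head a)"
      by force
    have swap: "(\<forall>d\<in>G. \<forall>b\<in>F. head d \<le> head b) \<longleftrightarrow> (\<forall>b\<in>F. \<forall>d\<in>G. head d \<le> head b)"
      by blast
    show ?thesis
      unfolding interlaced_def dis1 dis2 by (simp only: ball_simps swap ball_conj_distrib conj_ac)
  qed
  finally show ?thesis using True by (simp add: compatible_sets_def)
qed (simp add: compatible_sets_def)

text \<open>The union has at most N elements and the intersection at most one. In the extremal case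
  both bounds are attained, and the common element cuts \<open>{1..N}\<close> into the two
  sets.\<close>

lemma touching_sets:
  fixes X Y :: "nat set"
  assumes "X \<subseteq> {1..N}" "Y \<subseteq> {1..N}" "\<forall>x\<in>X. \<forall>y\<in>Y. x \<le> y"
  shows "card X + card Y \<le> N + 1"
    and "card X + card Y = N + 1 \<Longrightarrow> X = {1..card X} \<and> Y = {card X..N} \<and> X \<inter> Y = {card X}"
proof -
  have fin: "finite X" "finite Y" using assms(1,2)[THEN finite_subset] by simp_all
  then have sum: "card X + card Y = card (X \<union> Y) + card (X \<inter> Y)"
    by (rule card_Un_Int)
  have le: "card (X \<union> Y) \<le> N" using card_mono[of "{1..N}" "X \<union> Y"] assms by auto
  have one: "card (X \<inter> Y) \<le> 1"
  proof -
    have "\<forall>x\<in>X \<inter> Y. \<forall>y\<in>X \<inter> Y. x = y" using assms(3) by (blast intro: order_antisym)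
    then show ?thesis using fin by (simp add: card_le_Suc0_iff_eq)
  qed
  show "card X + card Y \<le> N + 1" using sum le one by linarith
  assume "card X + card Y = N + 1"
  then have "card (X \<union> Y) = N" "card (X \<inter> Y) = 1" using sum le one by linarith+
  then obtain p where p: "X \<inter> Y = {p}" and un: "X \<union> Y = {1..N}"
    using assms card_subset_eq[of "{1..N}" "X \<union> Y"] by (auto simp: card_1_singleton_iff)
  have "p \<in> X" "p \<in> Y" "1 \<le> p" using p assms by auto
  have "X = {1..p}"
  proof
    show "X \<subseteq> {1..p}" using assms \<open>p \<in> Y\<close> by auto
    show "{1..p} \<subseteq> X"
    proof
      fix x assume "x \<in> {1..p}"
      moreover have "p \<le> N" using \<open>p \<in> X\<close> assms(1) by auto
      ultimately have "x \<in> X \<union> Y" unfolding un by auto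
      then show "x \<in> X"
        using \<open>x \<in> {1..p}\<close> \<open>p \<in> X\<close> assms(3) by (metis UnE atLeastAtMost_iff order_antisym)
    qed
  qed
  moreover have "Y = {p..N}"
  proof
    show "Y \<subseteq> {p..N}" using assms \<open>p \<in> X\<close> by auto
    show "{p..N} \<subseteq> Y"
    proof
      fix x assume "x \<in> {p..N}"
      then have "x \<in> X \<union> Y" unfolding un using \<open>1 \<le> p\<close> by auto
      then show "x \<in> Y"
        using \<open>x \<in> {p..N}\<close> \<open>p \<in> Y\<close> assms(3) by (metis UnE atLeastAtMost_iff order_antisym)
    qed
  qed
  ultimately show "X = {1..card X} \<and> Y = {card X..N} \<and> X \<inter> Y = {card X}" using p by simp
qed

text \<open>In the extremal case the sets partition \<open>{1..N}\<close>, and \<open>X\<close> is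
  closed downwards, hence an initial segment.\<close>

lemma separated_sets:
  fixes X Y :: "nat set"
  assumes "X \<subseteq> {1..N}" "Y \<subseteq> {1..N}" "\<forall>x\<in>X. \<forall>y\<in>Y. x < y"
  shows "card X + card Y \<le> N"
    and "card X + card Y = N \<Longrightarrow> X = {1..card X} \<and> Y = {card X + 1..N}"
proof -
  have fin: "finite X" "finite Y" using assms(1,2)[THEN finite_subset] by simp_all
  have sum: "card (X \<union> Y) = card X + card Y"
    using assms(3) by (intro card_Un_disjoint fin) auto
  show "card X + card Y \<le> N" using card_mono[of "{1..N}" "X \<union> Y"] assms sum by auto
  assume eq: "card X + card Y = N"
  then have un: "X \<union> Y = {1..N}"
    using assms sum card_subset_eq[of "{1..N}" "X \<union> Y"] by auto
  have down: "y \<in> X" if "x \<in> X" "1 \<le> y" "y \<le> x" for x y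
  proof -
    have "y \<le> N" using that assms(1) by (auto dest: subsetD)
    then have "y \<in> X \<union> Y" unfolding un using that by simp
    then show ?thesis using that assms(3) by force
  qed
  have X: "X = {1..card X}"
  proof (cases "X = {}")
    case False
    then have "X = {1..Max X}"
    proof (intro subset_antisym subsetI)
      fix x assume "x \<in> X"
      then show "x \<in> {1..Max X}" using fin(1) assms(1) by auto
    next
      fix x assume "x \<in> {1..Max X}"
      then show "x \<in> X" using down[of "Max X" x] Max_in[OF fin(1) False] by simp
    qed
    then show ?thesis by (metis card_atLeastAtMost diff_Suc_1)
  qed simp
  define m where "m = card X"
  have "Y = {1..N} - X" using un assms(3) by blast
  also have "\<dots> = {m + 1..N}" unfolding X[folded m_def] by auto
  finally show "X = {1..card X} \<and> Y = {card X + 1..N}" using X by (simp add: m_def)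
qed

text \<open>With both directions present, the two staircase bounds each lose one against n + 2 ends;
  with a single direction, one bound loses one against the n + 1 of
  \<open>separated_sets\<close>.\<close>

lemma card_compatible_set_le:
  assumes "s \<noteq> 0" "t \<noteq> 0" "n \<ge> 1" "\<sigma> \<in> compatible_sets n s t"
  shows "card \<sigma> \<le> n"
proof -
  define F G where "F = {a \<in> \<sigma>. forward a}" and "G = {a \<in> \<sigma>. backward a}"
  let ?A = "tail ` F" and ?B = "head ` F" and ?C = "tail ` G" and ?D = "head ` G"
  note * = assms(4)[unfolded compatible_sets_iff, folded F_def G_def]
  then have rng: "?A \<subseteq> {1..n+1}" "?B \<subseteq> {1..n+1}" "?C \<subseteq> {1..n+1}" "?D \<subseteq> {1..n+1}"
    by (auto simp: F_def G_def arrows_def)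
  then have fin: "finite ?A" "finite ?B" "finite ?C" "finite ?D"
    using rng[THEN finite_subset] by simp_all
  have \<sigma>: "\<sigma> = F \<union> G" "F \<inter> G = {}"
    using * by (auto simp: F_def G_def forward_def backward_def arrows_def)
  have sub: "F \<subseteq> ?A \<times> ?B" "G \<subseteq> ?C \<times> ?D" by force+
  then have "finite F" "finite G" using fin sub[THEN finite_subset] by simp_all
  then have card: "card \<sigma> = card F + card G" using \<sigma> by (simp add: card_Un_disjoint)
  have inj: "inj (\<lambda>x. s * int x)" "inj (\<lambda>x. t * int x)" using assms by (auto intro: injI)
  have F: "card F + 1 \<le> card ?A + card ?B" if "F \<noteq> {}"
    using that * sub fin by (intro card_staircase_le[OF inj(1)]) auto
  have G: "card G + 1 \<le> card ?C + card ?D" if "G \<noteq> {}"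
    using that * sub fin by (intro card_staircase_le[OF inj(2)]) auto
  have il: "interlaced ?A ?B ?C ?D" using * by blast
  have "card ?A + card ?B \<le> n + 1"
    by (rule separated_sets(1)[OF rng(1,2) interlacedD(1)[OF il]])
  moreover have "card ?D + card ?C \<le> n + 1"
    by (rule separated_sets(1)[OF rng(4,3) interlacedD(2)[OF il]])
  moreover have "card (?A \<union> ?D) + card (?B \<union> ?C) \<le> n + 1 + 1"
    using rng interlaced_le[OF il] by (intro touching_sets(1)) blast+
  moreover have "card (?A \<union> ?D) = card ?A + card ?D" "card (?B \<union> ?C) = card ?B + card ?C"
    using interlacedD(3,4)[OF il]
    by (simp_all add: card_Un_disjoint[OF fin(1,4)] card_Un_disjoint[OF fin(2,3)])
  ultimately show ?thesis
    using F G card assms(3) by (cases "F = {}"; cases "G = {}") simp_all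
qed

subsection \<open>Counting\<close>

lemma card_subsets_insert:
  assumes "finite U" "p \<notin> U"
  shows "card {S. S \<subseteq> insert p U \<and> card S = i \<and> p \<notin> S} = card U choose i"
    and "1 \<le> i \<Longrightarrow> card {S. S \<subseteq> insert p U \<and> card S = i \<and> p \<in> S} = card U choose (i - 1)"
proof -
  have "{S. S \<subseteq> insert p U \<and> card S = i \<and> p \<notin> S} = {S. S \<subseteq> U \<and> card S = i}"
    using assms(2) by blast
  then show "card {S. S \<subseteq> insert p U \<and> card S = i \<and> p \<notin> S} = card U choose i"
    using n_subsets[OF assms(1)] by simp
  assume i: "1 \<le> i"
  have "{S. S \<subseteq> insert p U \<and> card S = i \<and> p \<in> S} = insert p ` {S. S \<subseteq> U \<and> card S = i - 1}"
  proof (intro set_eqI iffI)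
    fix S assume S: "S \<in> {S. S \<subseteq> insert p U \<and> card S = i \<and> p \<in> S}"
    then have "S - {p} \<subseteq> U" "card (S - {p}) = i - 1" "S = insert p (S - {p})" by auto
    then show "S \<in> insert p ` {S. S \<subseteq> U \<and> card S = i - 1}" by blast
  next
    fix S assume "S \<in> insert p ` {S. S \<subseteq> U \<and> card S = i - 1}"
    then obtain S' where S': "S = insert p S'" "S' \<subseteq> U" "card S' = i - 1" by blast
    then have "finite S'" "p \<notin> S'" using assms finite_subset by auto
    then show "S \<in> {S. S \<subseteq> insert p U \<and> card S = i \<and> p \<in> S}"
      using S' i by auto
  qed
  moreover have "inj_on (insert p) {S. S \<subseteq> U \<and> card S = i - 1}"
    using assms(2) by (auto simp: inj_on_def dest!: insert_ident[THEN iffD1, rotated 2])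
  ultimately show "card {S. S \<subseteq> insert p U \<and> card S = i \<and> p \<in> S} = card U choose (i - 1)"
    using n_subsets[OF assms(1)] by (simp add: card_image)
qed

text \<open>\<open>A\<close> holds the tails of forward and \<open>C\<close> those of backward
  arrows, around the touching point \<open>p\<close>. The heads need no record, being the
  complements \<open>{p..N} - C\<close> and \<open>{1..p} - A\<close>.\<close>

definition tail_sets :: "nat \<Rightarrow> nat \<Rightarrow> nat \<Rightarrow> nat \<Rightarrow> (nat set \<times> nat set) set" where
  "tail_sets N p i j = {(A, C). A \<subseteq> {1..p} \<and> card A = i \<and> C \<subseteq> {p..N} \<and> card C = j \<and> (p \<in> A \<longleftrightarrow> p \<in> C)}"

lemma finite_tail_sets: "finite (tail_sets N p i j)"
  by (rule finite_subset[of _ "Pow {1..p} \<times> Pow {p..N}"]) (auto simp: tail_sets_def)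

text \<open>The point \<open>p\<close> lies in neither set or in both; either way the remaining
  choices among the p - 1 points below and the N - p points above are independent.\<close>

lemma card_tail_sets:
  assumes "1 \<le> p" "p \<le> N" "1 \<le> i" "1 \<le> j"
  shows "card (tail_sets N p i j) =
    ((p - 1) choose i) * ((N - p) choose j) + ((p - 1) choose (i - 1)) * ((N - p) choose (j - 1))"
proof -
  let ?U = "{1..<p}" and ?V = "{p<..N}"
  have ins: "{1..p} = insert p ?U" "{p..N} = insert p ?V" using assms by auto
  let ?P = "{S. S \<subseteq> insert p ?U \<and> card S = i \<and> p \<notin> S} \<times> {S. S \<subseteq> insert p ?V \<and> card S = j \<and> p \<notin> S}"
  let ?Q = "{S. S \<subseteq> insert p ?U \<and> card S = i \<and> p \<in> S} \<times> {S. S \<subseteq> insert p ?V \<and> card S = j \<and> p \<in> S}"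
  have "tail_sets N p i j = ?P \<union> ?Q"
    unfolding tail_sets_def ins by blast
  moreover have "?P \<inter> ?Q = {}" by blast
  moreover have "finite ?P" "finite ?Q" by simp_all
  ultimately have "card (tail_sets N p i j) = card ?P + card ?Q"
    by (simp add: card_Un_disjoint)
  then show ?thesis
    using assms by (simp add: card_cartesian_product card_subsets_insert)
qed

section \<open>Faces with n arrows of both directions\<close>

lemma interlaced_mono:
  assumes "interlaced A B C D" "A' \<subseteq> A" "B' \<subseteq> B" "C' \<subseteq> C" "D' \<subseteq> D"
  shows "interlaced A' B' C' D'"
  using assms unfolding interlaced_def by - (elim conjE, intro conjI; blast)

text \<open>The value of \<open>p\<close> is i + (l + 1 - j), the number of left ends when
  \<open>D\<close> has l + 1 - j elements; the size of \<open>B\<close> then follows from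
  \<open>N\<close>.\<close>

lemma tail_setsD:
  assumes "(A, C) \<in> tail_sets N p i j" "p = i + l + 1 - j" "N = k + l + 1"
    "i \<in> {1..k}" "j \<in> {1..l}"
  defines "B \<equiv> {p..N} - C" and "D \<equiv> {1..p} - A"
  shows "interlaced A B C D"
    and "A \<subseteq> {1..N}" "B \<subseteq> {1..N}" "C \<subseteq> {1..N}" "D \<subseteq> {1..N}"
    and "card A = i" "card B = k + 1 - i" "card C = j" "card D = l + 1 - j"
proof -
  have AC: "A \<subseteq> {1..p}" "card A = i" "C \<subseteq> {p..N}" "card C = j" "p \<in> A \<longleftrightarrow> p \<in> C"
    using assms(1) by (auto simp: tail_sets_def)
  have p: "1 \<le> p" "p \<le> N" using assms(2-5) by auto
  show "A \<subseteq> {1..N}" "B \<subseteq> {1..N}" "C \<subseteq> {1..N}" "D \<subseteq> {1..N}"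
    using AC(1,3) p by (auto simp: B_def D_def)
  show "card A = i" "card C = j" by fact+
  have "finite A" "finite C" using AC(1,3) by (auto intro: finite_subset)
  then show "card B = k + 1 - i" "card D = l + 1 - j"
    using AC(1-4) assms(2-5) by (auto simp: B_def D_def card_Diff_subset)
  have left: "a \<le> p" if "a \<in> A \<union> D" for a using that AC(1) by (auto simp: D_def)
  have right: "p \<le> b" if "b \<in> B \<union> C" for b using that AC(3) by (auto simp: B_def)
  \<comment> \<open>A left and a right end can coincide only at \<open>p\<close>, which belongs to
    \<open>A\<close> and \<open>C\<close> or to \<open>B\<close> and \<open>D\<close>, where
    equality is permitted.\<close>
  have less: "a < b" if "a \<in> A \<union> D" "b \<in> B \<union> C" "\<not> (a = p \<and> b = p)" for a b
    using left[OF that(1)] right[OF that(2)] that(3) by linarith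
  show "interlaced A B C D"
    unfolding interlaced_def
  proof (intro conjI ballI)
    show "a < b" if "a \<in> A" "b \<in> B" for a b
      using that AC(5) by (intro less) (auto simp: B_def)
    show "d < c" if "d \<in> D" "c \<in> C" for d c
      using that AC(5) by (intro less) (auto simp: D_def)
    show "a \<le> c" if "a \<in> A" "c \<in> C" for a c
      using left[of a] right[of c] that by simp
    show "d \<le> b" if "d \<in> D" "b \<in> B" for d b
      using left[of d] right[of b] that by simp
  qed (auto simp: B_def D_def)
qed

text \<open>As \<open>A\<close> lies below \<open>B\<close> and \<open>D\<close> below
  \<open>C\<close>, the direction of an arrow tells \<open>F\<close> from \<open>G\<close>, so the
  union determines both.\<close>

lemma staircase_union_compatible:
  assumes "s \<noteq> 0" "t \<noteq> 0" "interlaced A B C D"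
    and "A \<subseteq> {1..n+1}" "B \<subseteq> {1..n+1}" "C \<subseteq> {1..n+1}" "D \<subseteq> {1..n+1}"
    and F: "F \<subseteq> A \<times> B" "staircase (\<lambda>x. s * int x) F"
    and G: "G \<subseteq> C \<times> D" "staircase (\<lambda>x. t * int x) G"
  shows "F \<union> G \<in> compatible_sets n s t" "{a \<in> F \<union> G. forward a} = F" "{a \<in> F \<union> G. backward a} = G"
proof -
  note il = interlacedD(1,2)[OF assms(3)]
  have fw: "forward a" "\<not> backward a" if "a \<in> F" for a
    using that F(1) il(1) by (fastforce simp: forward_def backward_def)+
  have bw: "backward a" "\<not> forward a" if "a \<in> G" for a
    using that G(1) il(2) by (fastforce simp: forward_def backward_def)+
  show parts: "{a \<in> F \<union> G. forward a} = F" "{a \<in> F \<union> G. backward a} = G"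
    using fw bw by blast+
  have "tail ` F \<subseteq> A" "head ` F \<subseteq> B" "tail ` G \<subseteq> C" "head ` G \<subseteq> D"
    using F(1) G(1) by auto
  then have "interlaced (tail ` F) (head ` F) (tail ` G) (head ` G)"
    by (rule interlaced_mono[OF assms(3)])
  moreover have "F \<union> G \<subseteq> arrows n"
  proof
    fix a assume a: "a \<in> F \<union> G"
    then have "tail a \<noteq> head a" using fw(1)[of a] bw(1)[of a] by (auto simp: forward_def backward_def)
    moreover have "a \<in> A \<times> B \<union> C \<times> D" using a F(1) G(1) by blast
    then have "tail a \<in> {1..n+1}" "head a \<in> {1..n+1}"
      using assms(4-7) by auto
    ultimately show "a \<in> arrows n" by (cases a) (simp add: arrows_def)
  qed
  ultimately show "F \<union> G \<in> compatible_sets n s t"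
    using F(2) G(2) unfolding compatible_sets_iff parts by simp
qed

text \<open>A face with n arrows attains every size bound, so its tails determine its heads. Here
  \<open>p\<close> is the number of left ends, written with tails only by means of
  \<open>card C + card D = l + 1\<close>.\<close>

lemma compatible_set_parts:
  assumes "s \<noteq> 0" "t \<noteq> 0" "\<sigma> \<in> compatible_sets n s t" "has_counts k l \<sigma>" "n = k + l" "1 \<le> k" "1 \<le> l"
  defines "F \<equiv> {a \<in> \<sigma>. forward a}" and "G \<equiv> {a \<in> \<sigma>. backward a}"
  defines "A \<equiv> tail ` F" and "C \<equiv> tail ` G"
  defines "p \<equiv> card A + l + 1 - card C"
  shows "\<sigma> = F \<union> G" "card A \<in> {1..k}" "card C \<in> {1..l}"
    and "(A, C) \<in> tail_sets (n + 1) p (card A) (card C)"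
    and "F \<in> full_staircases (\<lambda>x. s * int x) A ({p..n+1} - C)"
    and "G \<in> full_staircases (\<lambda>x. t * int x) C ({1..p} - A)"
proof -
  define B D where "B = head ` F" and "D = head ` G"
  note * = assms(3)[unfolded compatible_sets_iff, folded F_def G_def, folded A_def B_def C_def D_def]
  have card: "card F = k" "card G = l"
    using assms(4) by (simp_all add: has_counts_def F_def G_def)
  have rng: "A \<subseteq> {1..n+1}" "B \<subseteq> {1..n+1}" "C \<subseteq> {1..n+1}" "D \<subseteq> {1..n+1}"
    using * by (auto simp: F_def G_def A_def B_def C_def D_def arrows_def)
  then have fin: "finite A" "finite B" "finite C" "finite D"
    using rng[THEN finite_subset] by simp_all
  show "\<sigma> = F \<union> G"
    using * by (auto simp: F_def G_def forward_def backward_def arrows_def)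
  have sub: "F \<subseteq> A \<times> B" "G \<subseteq> C \<times> D"
    unfolding A_def B_def C_def D_def by force+
  have "F \<noteq> {}" "G \<noteq> {}" using card assms(6,7) by auto
  then have ne: "A \<noteq> {}" "B \<noteq> {}" "C \<noteq> {}" "D \<noteq> {}"
    by (simp_all add: A_def B_def C_def D_def)
  then have pos: "0 < card A" "0 < card B" "0 < card C" "0 < card D"
    using fin by (simp_all add: card_gt_0_iff)
  have inj: "inj (\<lambda>x. s * int x)" "inj (\<lambda>x. t * int x)" using assms(1,2) by (auto intro: injI)
  have st: "staircase (\<lambda>x. s * int x) F" "staircase (\<lambda>x. t * int x) G" using * by simp_all
  have le: "k + 1 \<le> card A + card B" "l + 1 \<le> card C + card D"
    using card_staircase_le[OF inj(1) fin(1) ne(1) fin(2) ne(2) st(1) sub(1)]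
      card_staircase_le[OF inj(2) fin(3) ne(3) fin(4) ne(4) st(2) sub(2)] card by simp_all
  have il: "interlaced A B C D" using * by simp
  have un: "card (A \<union> D) = card A + card D" "card (B \<union> C) = card B + card C"
    using interlacedD(3,4)[OF il]
    by (simp_all add: card_Un_disjoint[OF fin(1,4)] card_Un_disjoint[OF fin(2,3)])
  have touch: "A \<union> D \<subseteq> {1..n+1}" "B \<union> C \<subseteq> {1..n+1}" using rng by simp_all
  note touch = touch interlaced_le[OF il]
  \<comment> \<open>The staircase bounds add up to (k + 1) + (l + 1) = n + 2, which is also the
    upper bound of \<open>touching_sets\<close>, so both are tight.\<close>
  have eq: "card A + card B = k + 1" "card C + card D = l + 1"
    using touching_sets(1)[OF touch] le un assms(5) by linarith+
  then have p: "p = card (A \<union> D)" unfolding p_def un using pos by linarith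
  have "card (A \<union> D) + card (B \<union> C) = (n + 1) + 1"
    using un eq assms(5) by linarith
  from touching_sets(2)[OF touch this, folded p]
  have XY: "A \<union> D = {1..p}" "B \<union> C = {p..n+1}" "(A \<union> D) \<inter> (B \<union> C) = {p}"
    by blast+
  have BD: "B = {p..n+1} - C" "D = {1..p} - A"
    using XY(1,2) interlacedD(3,4)[OF il] by blast+
  \<comment> \<open>The point \<open>p\<close> is a left and a right end; as \<open>A\<close> misses
    \<open>B\<close> and \<open>C\<close> misses \<open>D\<close>, it is a common tail or a common
    head.\<close>
  have "p \<in> A \<longleftrightarrow> p \<in> C"
  proof -
    have "p \<notin> A \<inter> B" "p \<notin> C \<inter> D" using interlacedD(1,2)[OF il] by blast+
    moreover have "p \<in> (A \<union> D) \<inter> (B \<union> C)" unfolding XY(3) by simp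
    ultimately show ?thesis using interlacedD(3,4)[OF il] by blast
  qed
  then show "(A, C) \<in> tail_sets (n + 1) p (card A) (card C)"
    using XY(1,2) by (auto simp: tail_sets_def)
  show "card A \<in> {1..k}" "card C \<in> {1..l}" using eq pos by auto
  show "F \<in> full_staircases (\<lambda>x. s * int x) A ({p..n+1} - C)"
    using sub(1) st(1) card(1) eq(1) unfolding BD(1)[symmetric] full_staircases_def by simp
  show "G \<in> full_staircases (\<lambda>x. t * int x) C ({1..p} - A)"
    using sub(2) st(2) card(2) eq(2) unfolding BD(2)[symmetric] full_staircases_def by simp
qed

text \<open>A bijection turns faces into nested choices: the sizes i and j, the tail sets, and one
  full staircase per direction.\<close>

lemma card_compatible_sets_mixed:
  assumes "s \<noteq> 0" "t \<noteq> 0" "n = k + l" "1 \<le> k" "1 \<le> l"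
  shows "card {\<sigma> \<in> compatible_sets n s t. has_counts k l \<sigma>} =
    (\<Sum>i=1..k. \<Sum>j=1..l. ((k - 1) choose (i - 1)) * ((l - 1) choose (j - 1)) *
       (((l + i - j) choose i) * ((k - i + j) choose j) +
        ((l + i - j) choose (i - 1)) * ((k - i + j) choose (j - 1))))"
    (is "card ?S = _")
proof -
  define N where "N = n + 1"
  define p where "p = (\<lambda>ij :: nat \<times> nat. fst ij + l + 1 - snd ij)"
  define R where "R = (\<lambda>ij. tail_sets N (p ij) (fst ij) (snd ij))"
  define W where "W = (\<lambda>ij. \<lambda>AC :: nat set \<times> nat set.
    full_staircases (\<lambda>x. s * int x) (fst AC) ({p ij..N} - snd AC) \<times>
    full_staircases (\<lambda>x. t * int x) (snd AC) ({1..p ij} - fst AC))"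
  define Z where "Z = Sigma ({1..k} \<times> {1..l}) (\<lambda>ij. Sigma (R ij) (W ij))"
  define u :: "(nat \<times> nat) \<times> (nat set \<times> nat set) \<times> (arrow set \<times> arrow set) \<Rightarrow> arrow set"
    where "u = (\<lambda>(ij, AC, F, G). F \<union> G)"
  \<comment> \<open>All components before \<open>(F, G)\<close> are redundant and serve to split the
    count into iterated sums; they are read back from the face as tail sets and their sizes.\<close>
  define r :: "arrow set \<Rightarrow> (nat \<times> nat) \<times> (nat set \<times> nat set) \<times> (arrow set \<times> arrow set)"
    where "r = (\<lambda>\<sigma>. let F = {a \<in> \<sigma>. forward a}; G = {a \<in> \<sigma>. backward a} in
      ((card (tail ` F), card (tail ` G)), (tail ` F, tail ` G), (F, G)))"
  have inj: "inj (\<lambda>x. s * int x)" "inj (\<lambda>x. t * int x)" using assms(1,2) by (auto intro: injI)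
  have N: "N = k + l + 1" by (simp add: N_def assms(3))
  have Z: "u z \<in> ?S \<and> r (u z) = z" if "z \<in> Z" for z
  proof -
    obtain i j A C F G where z: "z = ((i, j), (A, C), (F, G))" by (metis surj_pair)
    define q where "q = i + l + 1 - j"
    define B D where "B = {q..N} - C" and "D = {1..q} - A"
    have ij: "i \<in> {1..k}" "j \<in> {1..l}" and AC: "(A, C) \<in> tail_sets N q i j"
      and F: "F \<in> full_staircases (\<lambda>x. s * int x) A B" and G: "G \<in> full_staircases (\<lambda>x. t * int x) C D"
      using that by (auto simp: z Z_def R_def W_def p_def q_def B_def D_def)
    note D = tail_setsD[OF AC q_def N ij, folded B_def D_def]
    have fin: "finite A" "finite B" "finite C" "finite D"
      using D(2-5)[THEN finite_subset] by simp_all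
    have ne: "A \<noteq> {}" "B \<noteq> {}" "C \<noteq> {}" "D \<noteq> {}"
      using D(6-9) ij by auto
    have img: "tail ` F = A" "tail ` G = C"
      using fst_snd_full_staircase(1)[OF inj(1) fin(1) ne(1) fin(2) ne(2) F]
        fst_snd_full_staircase(1)[OF inj(2) fin(3) ne(3) fin(4) ne(4) G] by simp_all
    have F': "F \<subseteq> A \<times> B" "staircase (\<lambda>x. s * int x) F" "card F + 1 = card A + card B"
      and G': "G \<subseteq> C \<times> D" "staircase (\<lambda>x. t * int x) G" "card G + 1 = card C + card D"
      using F G by (simp_all add: full_staircases_def)
    note un = staircase_union_compatible[OF assms(1,2) D(1) D(2-5)[unfolded N_def] F'(1,2) G'(1,2)]
    have "card F = k" "card G = l"
      using F'(3) G'(3) D(6-9) ij by auto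
    then have "has_counts k l (F \<union> G)" unfolding has_counts_def un by simp
    then show ?thesis
      using un(1) img D(6,8) unfolding z u_def r_def prod.case Let_def un(2,3) by simp
  qed
  have "inj_on u Z"
    using Z by (intro inj_on_inverseI[of _ r]) blast
  moreover have "u ` Z = ?S"
  proof
    show "u ` Z \<subseteq> ?S" using Z by blast
    show "?S \<subseteq> u ` Z"
    proof
      fix \<sigma> assume "\<sigma> \<in> ?S"
      then have \<sigma>: "\<sigma> \<in> compatible_sets n s t" "has_counts k l \<sigma>" by simp_all
      note P = compatible_set_parts[OF assms(1,2) \<sigma> assms(3-5)]
      have "r \<sigma> \<in> Z"
        unfolding r_def Let_def Z_def R_def W_def p_def N_def using P(2-6) by simp
      moreover have "u (r \<sigma>) = \<sigma>"
        using P(1) by (simp add: u_def r_def Let_def)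
      ultimately show "\<sigma> \<in> u ` Z" by (metis imageI)
    qed
  qed
  ultimately have "card ?S = card Z" by (metis card_image)
  also have "\<dots> = (\<Sum>ij\<in>{1..k} \<times> {1..l}. \<Sum>AC\<in>R ij. card (W ij AC))"
  proof -
    have "finite (W ij AC)" if "AC \<in> R ij" for ij AC
    proof -
      have "fst AC \<subseteq> {1..p ij}" "snd AC \<subseteq> {p ij..N}"
        using that by (auto simp: R_def tail_sets_def)
      from this[THEN finite_subset] show ?thesis
        by (simp add: W_def finite_full_staircases)
    qed
    then show ?thesis
      unfolding Z_def by (simp add: finite_tail_sets R_def)
  qed
  \<comment> \<open>The number of staircase pairs depends on sizes only: the sides of the grids add
    up to k + 1 and l + 1, whatever the tail sets are.\<close>
  also have "\<dots> = (\<Sum>ij\<in>{1..k} \<times> {1..l}. card (R ij) *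
      (((k - 1) choose (fst ij - 1)) * ((l - 1) choose (snd ij - 1))))"
  proof (intro sum.cong refl)
    fix ij assume ij: "ij \<in> {1..k} \<times> {1..l}"
    have "card (W ij AC) = ((k - 1) choose (fst ij - 1)) * ((l - 1) choose (snd ij - 1))"
      if "AC \<in> R ij" for AC
    proof -
      obtain i j A C where eq: "ij = (i, j)" "AC = (A, C)" by (metis surj_pair)
      have ij': "i \<in> {1..k}" "j \<in> {1..l}" using ij eq by simp_all
      have AC: "(A, C) \<in> tail_sets N (p ij) i j" using that eq by (simp add: R_def)
      have pij: "p ij = i + l + 1 - j" by (simp add: p_def eq)
      note D = tail_setsD[OF AC pij N ij']
      have fin: "finite A" "finite ({p ij..N} - C)" "finite C" "finite ({1..p ij} - A)"
        using D(2-5)[THEN finite_subset] by simp_all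
      have ne: "A \<noteq> {}" "{p ij..N} - C \<noteq> {}" "C \<noteq> {}" "{1..p ij} - A \<noteq> {}"
      proof -
        have "0 < card A" "0 < card ({p ij..N} - C)" "0 < card C" "0 < card ({1..p ij} - A)"
          using D(6-9) ij' by auto
        then show "A \<noteq> {}" "{p ij..N} - C \<noteq> {}" "C \<noteq> {}" "{1..p ij} - A \<noteq> {}"
          unfolding card_gt_0_iff by blast+
      qed
      show ?thesis
        using card_full_staircases[OF inj(1) fin(1) ne(1) fin(2) ne(2)]
          card_full_staircases[OF inj(2) fin(3) ne(3) fin(4) ne(4)] D(6-9) ij'
        by (simp add: W_def eq card_cartesian_product)
    qed
    then show "(\<Sum>AC\<in>R ij. card (W ij AC)) =
        card (R ij) * (((k - 1) choose (fst ij - 1)) * ((l - 1) choose (snd ij - 1)))"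
      by simp
  qed
  also have "\<dots> = (\<Sum>i=1..k. \<Sum>j=1..l. card (R (i, j)) * (((k - 1) choose (i - 1)) * ((l - 1) choose (j - 1))))"
    by (simp add: sum.cartesian_product case_prod_beta)
  also have "\<dots> = (\<Sum>i=1..k. \<Sum>j=1..l. ((k - 1) choose (i - 1)) * ((l - 1) choose (j - 1)) *
       (((l + i - j) choose i) * ((k - i + j) choose j) +
        ((l + i - j) choose (i - 1)) * ((k - i + j) choose (j - 1))))"
  proof (intro sum.cong refl)
    fix i j assume ij: "i \<in> {1..k}" "j \<in> {1..l}"
    \<comment> \<open>This is the touching point; the points below and above it number l + i - j and
      k - i + j, the upper entries of the binomials.\<close>
    define q where "q = i + l + 1 - j"
    have q: "1 \<le> q" "q \<le> N" "q - 1 = l + i - j" "N - q = k - i + j"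
      using ij by (auto simp: q_def N)
    have "card (R (i, j)) = ((l + i - j) choose i) * ((k - i + j) choose j) +
        ((l + i - j) choose (i - 1)) * ((k - i + j) choose (j - 1))"
      using card_tail_sets[of q N i j] q ij by (simp add: R_def p_def q_def)
    then show "card (R (i, j)) * (((k - 1) choose (i - 1)) * ((l - 1) choose (j - 1))) =
       ((k - 1) choose (i - 1)) * ((l - 1) choose (j - 1)) *
       (((l + i - j) choose i) * ((k - i + j) choose j) +
        ((l + i - j) choose (i - 1)) * ((k - i + j) choose (j - 1)))"
      by simp
  qed
  finally show ?thesis .
qed

text \<open>The union is disjoint because a full staircase determines its first projection, and the
  sizes of its members form row n - 1 of Pascal's triangle.\<close>

lemma card_UN_full_staircases:
  fixes X Y :: "nat \<Rightarrow> nat set"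
  assumes "inj h" "n \<ge> 1" "\<And>m. m \<in> {1..n} \<Longrightarrow> card (X m) = m \<and> card (Y m) = n + 1 - m"
  shows "card (\<Union>m\<in>{1..n}. full_staircases h (X m) (Y m)) = 2 ^ (n - 1)"
proof -
  have fin: "finite (X m)" "X m \<noteq> {}" "finite (Y m)" "Y m \<noteq> {}" if "m \<in> {1..n}" for m
    using assms(3)[OF that] that by (auto intro: card_ge_0_finite)
  have "card (\<Union>m\<in>{1..n}. full_staircases h (X m) (Y m)) =
      (\<Sum>m=1..n. card (full_staircases h (X m) (Y m)))"
  proof (rule card_UN_disjoint)
    show "\<forall>m\<in>{1..n}. finite (full_staircases h (X m) (Y m))"
      using fin finite_full_staircases by blast
    show "\<forall>m\<in>{1..n}. \<forall>m'\<in>{1..n}. m \<noteq> m' \<longrightarrow>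
        full_staircases h (X m) (Y m) \<inter> full_staircases h (X m') (Y m') = {}"
    proof (intro ballI impI)
      fix m m' assume m: "m \<in> {1..n}" "m' \<in> {1..n}" "m \<noteq> m'"
      then have "X m \<noteq> X m'" using assms(3) by metis
      then show "full_staircases h (X m) (Y m) \<inter> full_staircases h (X m') (Y m') = {}"
        using fst_snd_full_staircase(1)[OF assms(1) fin[OF m(1)]]
          fst_snd_full_staircase(1)[OF assms(1) fin[OF m(2)]] by (metis disjoint_iff)
    qed
  qed simp
  also have "\<dots> = (\<Sum>m=1..n. (n - 1) choose (m - 1))"
  proof (intro sum.cong refl)
    fix m assume m: "m \<in> {1..n}"
    show "card (full_staircases h (X m) (Y m)) = (n - 1) choose (m - 1)"
      using card_full_staircases[OF assms(1) fin[OF m]] assms(3)[OF m] m by simp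
  qed
  also have "\<dots> = (\<Sum>m\<le>n - 1. (n - 1) choose m)"
    by (rule sum.reindex_bij_witness[of _ Suc "\<lambda>m. m - 1"]) (use assms(2) in auto)
  also have "\<dots> = 2 ^ (n - 1)" by (rule choose_row_sum)
  finally show ?thesis .
qed

section \<open>Facets with all arrows in one direction\<close>

lemma backward_iff: "a \<in> arrows n \<Longrightarrow> backward a \<longleftrightarrow> \<not> forward a"
  by (auto simp: arrows_def forward_def backward_def)

lemma has_counts_parts:
  assumes "\<sigma> \<subseteq> arrows n" "has_counts k l \<sigma>"
  shows "finite \<sigma>" "card \<sigma> = k + l"
proof -
  show "finite \<sigma>" using assms(1) finite_arrows finite_subset by blast
  moreover have "\<sigma> = {a \<in> \<sigma>. forward a} \<union> {a \<in> \<sigma>. backward a}"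
    "{a \<in> \<sigma>. forward a} \<inter> {a \<in> \<sigma>. backward a} = {}"
    using assms(1) by (auto simp: arrows_def forward_def backward_def)
  ultimately show "card \<sigma> = k + l"
    using assms(2) unfolding has_counts_def by (metis (no_types, lifting) card_Un_disjoint finite_Un)
qed

text \<open>All tails precede all heads, and a staircase of n arrows needs n + 1 ends, so the tails
  are an initial segment and the heads fill the rest.\<close>

lemma card_compatible_sets_forward:
  assumes "s \<noteq> 0" "t \<noteq> 0" "n \<ge> 1"
  shows "card {\<sigma> \<in> compatible_sets n s t. has_counts n 0 \<sigma>} = 2 ^ (n - 1)"
proof -
  let ?h = "\<lambda>x. s * int x" and ?X = "\<lambda>m. {1..m}" and ?Y = "\<lambda>m. {m+1..n+1}"
  have inj: "inj ?h" using assms(1) by (auto intro: injI)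
  have "{\<sigma> \<in> compatible_sets n s t. has_counts n 0 \<sigma>} = (\<Union>m\<in>{1..n}. full_staircases ?h (?X m) (?Y m))"
    (is "?L = ?R")
  proof (intro set_eqI iffI)
    fix \<sigma> assume "\<sigma> \<in> ?L"
    then have \<sigma>: "\<sigma> \<in> compatible_sets n s t" "has_counts n 0 \<sigma>" by simp_all
    then have arr: "\<sigma> \<subseteq> arrows n" by (simp add: compatible_sets_def)
    note fin = has_counts_parts[OF arr \<sigma>(2)]
    have "{a \<in> \<sigma>. backward a} = {}" using \<sigma>(2) fin(1) by (simp add: has_counts_def)
    then have parts: "{a \<in> \<sigma>. forward a} = \<sigma>" "{a \<in> \<sigma>. backward a} = {}"
      using arr backward_iff by blast+
    let ?A = "tail ` \<sigma>" and ?B = "head ` \<sigma>"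
    have *: "interlaced ?A ?B {} {}" "staircase ?h \<sigma>"
      using \<sigma>(1) unfolding compatible_sets_iff parts by simp_all
    have rng: "?A \<subseteq> {1..n+1}" "?B \<subseteq> {1..n+1}"
      using arr by (auto simp: arrows_def)
    have sub: "\<sigma> \<subseteq> ?A \<times> ?B" by force
    have ne: "\<sigma> \<noteq> {}" using fin(2) assms(3) by auto
    have "n + 1 \<le> card ?A + card ?B"
      using card_staircase_le[OF inj _ _ _ _ *(2) sub] fin ne by simp
    then have eq: "card ?A + card ?B = n + 1"
      using separated_sets(1)[OF rng interlacedD(1)[OF *(1)]] by linarith
    define m where "m = card ?A"
    have AB: "?A = {1..m}" "?B = {m + 1..n + 1}"
      using separated_sets(2)[OF rng interlacedD(1)[OF *(1)] eq] by (simp_all add: m_def)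
    have "0 < card ?A" "0 < card ?B" using ne fin(1) by (simp_all add: card_gt_0_iff)
    then have "m \<in> {1..n}" using eq unfolding m_def by auto
    moreover have "\<sigma> \<in> full_staircases ?h {1..m} {m + 1..n + 1}"
      using sub *(2) eq fin(2) unfolding full_staircases_def AB[symmetric] by simp
    ultimately show "\<sigma> \<in> ?R" by blast
  next
    fix \<sigma> assume "\<sigma> \<in> ?R"
    then obtain m where m: "m \<in> {1..n}" "\<sigma> \<in> full_staircases ?h (?X m) (?Y m)" by blast
    then have \<sigma>: "\<sigma> \<subseteq> ?X m \<times> ?Y m" "staircase ?h \<sigma>" "card \<sigma> = n"
      by (auto simp: full_staircases_def)
    have "interlaced (?X m) (?Y m) {} {}" by (auto simp: interlaced_def)
    from staircase_union_compatible[OF assms(1,2) this _ _ _ _ \<sigma>(1,2), of n "{}"]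
    have "\<sigma> \<in> compatible_sets n s t" "{a \<in> \<sigma>. forward a} = \<sigma>" "{a \<in> \<sigma>. backward a} = {}"
      using m(1) by (simp_all add: staircase_def)
    then show "\<sigma> \<in> ?L"
      using \<sigma>(3) by (simp only: has_counts_def mem_Collect_eq card.empty simp_thms)
  qed
  then show ?thesis
    using card_UN_full_staircases[OF inj assms(3), of ?X ?Y] by simp
qed

lemma card_compatible_sets_backward:
  assumes "s \<noteq> 0" "t \<noteq> 0" "n \<ge> 1"
  shows "card {\<sigma> \<in> compatible_sets n s t. has_counts 0 n \<sigma>} = 2 ^ (n - 1)"
proof -
  \<comment> \<open>For backward arrows the heads come first: the \<open>m\<close> tails are the
    largest indices.\<close>
  let ?h = "\<lambda>x. t * int x" and ?X = "\<lambda>m. {n+2-m..n+1}" and ?Y = "\<lambda>m. {1..n+1-m}"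
  have inj: "inj ?h" using assms(2) by (auto intro: injI)
  have "{\<sigma> \<in> compatible_sets n s t. has_counts 0 n \<sigma>} = (\<Union>m\<in>{1..n}. full_staircases ?h (?X m) (?Y m))"
    (is "?L = ?R")
  proof (intro set_eqI iffI)
    fix \<sigma> assume "\<sigma> \<in> ?L"
    then have \<sigma>: "\<sigma> \<in> compatible_sets n s t" "has_counts 0 n \<sigma>" by simp_all
    then have arr: "\<sigma> \<subseteq> arrows n" by (simp add: compatible_sets_def)
    note fin = has_counts_parts[OF arr \<sigma>(2)]
    have "{a \<in> \<sigma>. forward a} = {}" using \<sigma>(2) fin(1) by (simp add: has_counts_def)
    then have parts: "{a \<in> \<sigma>. backward a} = \<sigma>" "{a \<in> \<sigma>. forward a} = {}"
      using arr backward_iff by blast+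
    let ?C = "tail ` \<sigma>" and ?D = "head ` \<sigma>"
    have *: "interlaced {} {} ?C ?D" "staircase ?h \<sigma>"
      using \<sigma>(1) unfolding compatible_sets_iff parts by simp_all
    have rng: "?D \<subseteq> {1..n+1}" "?C \<subseteq> {1..n+1}"
      using arr by (auto simp: arrows_def)
    have sub: "\<sigma> \<subseteq> ?C \<times> ?D" by force
    have ne: "\<sigma> \<noteq> {}" using fin(2) assms(3) by auto
    have "n + 1 \<le> card ?C + card ?D"
      using card_staircase_le[OF inj _ _ _ _ *(2) sub] fin ne by simp
    then have eq: "card ?D + card ?C = n + 1"
      using separated_sets(1)[OF rng interlacedD(2)[OF *(1)]] by linarith
    define m where "m = card ?C"
    have pos: "0 < card ?C" "0 < card ?D" using ne fin(1) by (simp_all add: card_gt_0_iff)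
    then have m: "m \<in> {1..n}" "card ?D = n + 1 - m" "card ?D + 1 = n + 2 - m"
      using eq unfolding m_def by auto
    have CD: "?C = ?X m" "?D = ?Y m"
      using separated_sets(2)[OF rng interlacedD(2)[OF *(1)] eq] m(2,3) by metis+
    have "\<sigma> \<in> full_staircases ?h (?X m) (?Y m)"
      using sub *(2) eq fin(2) unfolding full_staircases_def CD[symmetric] by simp
    then show "\<sigma> \<in> ?R" using m(1) by blast
  next
    fix \<sigma> assume "\<sigma> \<in> ?R"
    then obtain m where m: "m \<in> {1..n}" "\<sigma> \<in> full_staircases ?h (?X m) (?Y m)" by blast
    then have \<sigma>: "\<sigma> \<subseteq> ?X m \<times> ?Y m" "staircase ?h \<sigma>" "card \<sigma> = n"
      by (auto simp: full_staircases_def)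
    have "interlaced {} {} (?X m) (?Y m)" using m(1) by (auto simp: interlaced_def)
    moreover have "?X m \<subseteq> {1..n+1}" "?Y m \<subseteq> {1..n+1}" using m(1) by auto
    ultimately have "\<sigma> \<in> compatible_sets n s t" "{a \<in> \<sigma>. backward a} = \<sigma>" "{a \<in> \<sigma>. forward a} = {}"
      using staircase_union_compatible[OF assms(1,2) _ _ _ _ _ _ _ \<sigma>(1,2), of "{}" "{}" n "{}"]
      by (simp_all add: staircase_def)
    then show "\<sigma> \<in> ?L"
      using \<sigma>(3) by (simp only: has_counts_def mem_Collect_eq card.empty simp_thms)
  qed
  then show ?thesis
    using card_UN_full_staircases[OF inj assms(3), of ?X ?Y] by auto
qed

text \<open>No face has more than n arrows, so each face with n arrows is maximal.\<close>

lemma facet_count_compatible_sets: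
  assumes "s \<noteq> 0" "t \<noteq> 0" "n \<ge> 1" "k + l = n"
  shows "facet_count (compatible_sets n s t) k l = face_count (compatible_sets n s t) k l"
proof -
  let ?K = "compatible_sets n s t"
  have "\<sigma> \<in> facets ?K" if \<sigma>: "\<sigma> \<in> ?K" "has_counts k l \<sigma>" for \<sigma>
  proof -
    have card: "card \<sigma> = n"
      using has_counts_parts(2) \<sigma> assms(4) by (auto simp: compatible_sets_def)
    have "\<tau> = \<sigma>" if \<tau>: "\<tau> \<in> ?K" "\<sigma> \<subseteq> \<tau>" for \<tau>
    proof -
      have "finite \<tau>"
        using \<tau>(1) finite_arrows finite_subset by (auto simp: compatible_sets_def)
      then show ?thesis
        using card_seteq[OF _ \<tau>(2)] card_compatible_set_le[OF assms(1-3) \<tau>(1)] card by simp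
    qed
    then show ?thesis using \<sigma>(1) by (simp add: facets_def)
  qed
  then have "{\<sigma> \<in> facets ?K. has_counts k l \<sigma>} = {\<sigma> \<in> ?K. has_counts k l \<sigma>}"
    by (auto simp: facets_def)
  then show ?thesis by (simp add: facet_count_def face_count_def)
qed

theorem theorem8p7:
  fixes n :: nat and e :: "nat \<Rightarrow> 'a::euclidean_space" and \<Delta> :: "arrow set set"
  assumes "n \<ge> 1"
    and "bij_betw e {1..n+1} Basis"
    and "uniform_flag_triangulation n e \<Delta>"
    and "revlex_class n \<Delta>"
  shows "(\<forall>k\<in>{1..n-1}.
            facet_count \<Delta> k (n - k) = face_count \<Delta> k (n - k) \<and>
            face_count \<Delta> k (n - k) =
              (\<Sum>i=1..k. \<Sum>j=1..n-k.
                 ((k - 1) choose (i - 1)) * ((n - k - 1) choose (j - 1)) *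
                 (((n - k + i - j) choose i) * ((k - i + j) choose j) +
                  ((n - k + i - j) choose (i - 1)) * ((k - i + j) choose (j - 1)))))
       \<and> facet_count \<Delta> n 0 = 2 ^ (n - 1)
       \<and> facet_count \<Delta> 0 n = 2 ^ (n - 1)"
proof -
  have tri: "flag_complex_on (arrows n) \<Delta>" "represents_boundary_triangulation n e \<Delta>" "uniform n \<Delta>"
    using assms(3) by (simp_all add: uniform_flag_triangulation_def)
  note geo = assms(2) tri(1,2)
  obtain s t :: int where st: "s \<noteq> 0" "t \<noteq> 0"
    and edge: "\<And>a b. a \<in> arrows n \<Longrightarrow> b \<in> arrows n \<Longrightarrow>
      {a, b} \<in> \<Delta> \<longleftrightarrow> compatible s t a b \<and> compatible s t b a"
    using edge_iff_compatible[OF edge_head_ne_tail[OF geo] diagonal_exists[OF geo]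
        diagonal_unique[OF geo] tri(3) assms(4)] by blast
  \<comment> \<open>Both sides are clique complexes of the same relation on arrows.\<close>
  have \<Delta>: "\<Delta> = compatible_sets n s t"
  proof (rule set_eqI)
    fix \<sigma>
    show "\<sigma> \<in> \<Delta> \<longleftrightarrow> \<sigma> \<in> compatible_sets n s t"
      unfolding face_iff_pairs[OF geo, of \<sigma>] compatible_sets_def mem_Collect_eq
      using edge by (meson subsetD)
  qed
  show ?thesis
  proof (intro conjI ballI)
    fix k assume k: "k \<in> {1..n - 1}"
    then have n: "n = k + (n - k)" "1 \<le> k" "1 \<le> n - k" by auto
    show "facet_count \<Delta> k (n - k) = face_count \<Delta> k (n - k)"
      unfolding \<Delta> by (rule facet_count_compatible_sets[OF st assms(1) n(1)[symmetric]])
    show "face_count \<Delta> k (n - k) =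
              (\<Sum>i=1..k. \<Sum>j=1..n-k.
                 ((k - 1) choose (i - 1)) * ((n - k - 1) choose (j - 1)) *
                 (((n - k + i - j) choose i) * ((k - i + j) choose j) +
                  ((n - k + i - j) choose (i - 1)) * ((k - i + j) choose (j - 1))))"
      unfolding \<Delta> face_count_def by (rule card_compatible_sets_mixed[OF st n])
  next
    show "facet_count \<Delta> n 0 = 2 ^ (n - 1)"
      using facet_count_compatible_sets[OF st assms(1), of n 0]
        card_compatible_sets_forward[OF st assms(1)] by (simp add: \<Delta> face_count_def)
    show "facet_count \<Delta> 0 n = 2 ^ (n - 1)"
      using facet_count_compatible_sets[OF st assms(1), of 0 n]
        card_compatible_sets_backward[OF st assms(1)] by (simp add: \<Delta> face_count_def)
  qed
qed

end
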